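(* Let $H$ be a complex, separable, infinite dimensional Hilbert space and let $T\in L(H)$ be such that $0\in reg(T)$. Then $$\mathrm{dist}(0,\sigma_g(T))=\sup\left\{\frac{1}{r_\sigma(S)} : S\in L(H),\ TST=T\right\},$$ where $r_\sigma(S)$ is the spectral radius of $S$.
   Context: $L(H)$ is the algebra of all continuous linear operators on $H$ and $I$ is the identity operator. The set $reg(T)$ consists of all $\lambda\in\mathbb{C}$ for which there exist a neighborhood $U_\lambda$ of $\lambda$ and an analytic operator-valued function $F:U_\lambda\to L(H)$ such that $(\mu I-T)F(\mu)(\mu I-T)=\mu I-T$ and $F(\mu)(\mu I-T)F(\mu)=F(\mu)$ for all $\mu\in U_\lambda$. The generalized spectrum of $T$ is $\sigma_g(T)=\mathbb{C}\setminus reg(T)$, and $\mathrm{dist}(0,\sigma_g(T))=\inf\{|\lambda|:\lambda\in\sigma_g(T)\}$. The convention $1/0=+\infty$ is used. *)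

theory Defs
  imports "HOL-Analysis.Analysis"
begin

class scaleC = scaleR +
  fixes scaleC :: "complex \<Rightarrow> 'a \<Rightarrow> 'a" (infixr "*\<^sub>C" 75)
  assumes scaleR_scaleC: "r *\<^sub>R x = complex_of_real r *\<^sub>C x"

class complex_vector = scaleC + real_vector +
  assumes scaleC_add_right: "a *\<^sub>C (x + y) = a *\<^sub>C x + a *\<^sub>C y"
    and scaleC_add_left: "(a + b) *\<^sub>C x = a *\<^sub>C x + b *\<^sub>C x"
    and scaleC_scaleC: "a *\<^sub>C (b *\<^sub>C x) = (a * b) *\<^sub>C x"
    and scaleC_one: "1 *\<^sub>C x = x"

global_interpretation complex_vector: vector_space "scaleC :: complex \<Rightarrow> 'a \<Rightarrow> 'a :: complex_vector"
  defines cspan = complex_vector.span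
  by unfold_locales (rule scaleC_add_right scaleC_add_left scaleC_scaleC scaleC_one)+

class complex_normed_vector = complex_vector + real_normed_vector +
  assumes norm_scaleC: "norm (a *\<^sub>C x) = cmod a * norm x"

text \<open>The inner product is linear in its first argument.\<close>

class complex_inner = complex_vector + real_normed_vector +
  fixes cinner :: "'a \<Rightarrow> 'a \<Rightarrow> complex"
  assumes cinner_commute: "cinner x y = cnj (cinner y x)"
    and cinner_add_left: "cinner (x + y) z = cinner x z + cinner y z"
    and cinner_scaleC_left: "cinner (a *\<^sub>C x) y = a * cinner x y"
    and cinner_norm: "cinner x x = complex_of_real ((norm x)\<^sup>2)"
begin

subclass complex_normed_vector
proof
  fix a :: complex and x :: 'a
  have "complex_of_real ((norm (a *\<^sub>C x))\<^sup>2) = a * cinner x (a *\<^sub>C x)"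
    by (metis cinner_norm cinner_scaleC_left)
  also have "cinner x (a *\<^sub>C x) = cnj a * cinner x x"
    by (metis cinner_commute cinner_scaleC_left complex_cnj_mult)
  also have "a * (cnj a * cinner x x) = complex_of_real ((cmod a * norm x)\<^sup>2)"
    by (simp only: cinner_norm mult.assoc[symmetric] complex_norm_square[symmetric]
        power_mult_distrib of_real_mult of_real_power)
  finally have "(norm (a *\<^sub>C x))\<^sup>2 = (cmod a * norm x)\<^sup>2"
    by (simp only: of_real_eq_iff)
  then show "norm (a *\<^sub>C x) = cmod a * norm x"
    by (simp add: power2_eq_iff_nonneg)
qed

end

class complex_hilbert_space = complex_inner + complete_space

lemma bounded_linear_scaleC: "bounded_linear (\<lambda>x :: 'a :: complex_normed_vector. a *\<^sub>C x)"
  by (rule bounded_linear_intro[where K = "cmod a"])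
    (simp_all add: scaleC_add_right scaleR_scaleC scaleC_scaleC norm_scaleC mult.commute)

text \<open>
  Elements of the library type of bounded operators are only real-linear. Pointwise complex
  multiplication turns this type into a complex normed space; the algebra of complex-linear
  operators is the subset \<open>clinear_ops\<close>.
\<close>

instantiation blinfun :: (real_normed_vector, complex_normed_vector) complex_normed_vector
begin

lift_definition scaleC_blinfun :: "complex \<Rightarrow> 'a \<Rightarrow>\<^sub>L 'b \<Rightarrow> 'a \<Rightarrow>\<^sub>L 'b"
  is "\<lambda>c A x. c *\<^sub>C A x"
  by (rule bounded_linear_compose[OF bounded_linear_scaleC])

instance
proof
  fix a b :: complex and r :: real and A B :: "'a \<Rightarrow>\<^sub>L 'b"
  show "r *\<^sub>R A = complex_of_real r *\<^sub>C A"
    by transfer (simp add: scaleR_scaleC)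
  show "a *\<^sub>C (A + B) = a *\<^sub>C A + a *\<^sub>C B"
    by transfer (simp add: scaleC_add_right)
  show "(a + b) *\<^sub>C A = a *\<^sub>C A + b *\<^sub>C A"
    by transfer (simp add: scaleC_add_left)
  show "a *\<^sub>C (b *\<^sub>C A) = (a * b) *\<^sub>C A"
    by transfer (simp add: scaleC_scaleC)
  show "1 *\<^sub>C A = A"
    by transfer (simp add: scaleC_one)
  have le: "norm (c *\<^sub>C C) \<le> cmod c * norm C" for c and C :: "'a \<Rightarrow>\<^sub>L 'b"
  proof (rule norm_blinfun_bound)
    show "norm (blinfun_apply (c *\<^sub>C C) x) \<le> cmod c * norm C * norm x" for x
      using norm_blinfun[of C x]
      by (simp add: scaleC_blinfun.rep_eq norm_scaleC mult.assoc mult_left_mono)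
  qed simp
  show "norm (a *\<^sub>C A) = cmod a * norm A"
  proof (cases "a = 0")
    case True
    then show ?thesis using le[of a A] by simp
  next
    case False
    have "A = inverse a *\<^sub>C a *\<^sub>C A"
      using False by transfer (simp add: scaleC_scaleC scaleC_one)
    then have "norm A \<le> cmod (inverse a) * norm (a *\<^sub>C A)"
      using le[of "inverse a" "a *\<^sub>C A"] by simp
    then have "cmod a * norm A \<le> norm (a *\<^sub>C A)"
      using False by (simp add: norm_divide norm_inverse divide_simps mult.commute)
    then show ?thesis using le[of a A] by simp
  qed
qed

end

definition clinear_ops :: "('a :: complex_normed_vector \<Rightarrow>\<^sub>L 'a) set" where
  "clinear_ops = {A. \<forall>c x. blinfun_apply A (c *\<^sub>C x) = c *\<^sub>C blinfun_apply A x}"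

definition op_spectrum :: "('a :: complex_normed_vector \<Rightarrow>\<^sub>L 'a) \<Rightarrow> complex set" where
  "op_spectrum A = {z. \<not> (\<exists>B \<in> clinear_ops.
     (z *\<^sub>C id_blinfun - A) o\<^sub>L B = id_blinfun \<and> B o\<^sub>L (z *\<^sub>C id_blinfun - A) = id_blinfun)}"

text \<open>Extended-real valued, so that \<open>1 / 0 = \<infinity>\<close>.\<close>

definition spectral_radius :: "('a :: complex_normed_vector \<Rightarrow>\<^sub>L 'a) \<Rightarrow> ereal" where
  "spectral_radius A = (SUP z\<in>op_spectrum A. ereal (cmod z))"

text \<open>Holomorphy of vector-valued functions, for use on open \<open>U\<close>: complex differentiability at every point
  of \<open>U\<close>, with respect to the norm of the codomain.\<close>

definition vector_holomorphic_on :: "(complex \<Rightarrow> 'b :: complex_normed_vector) \<Rightarrow> complex set \<Rightarrow> bool" where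
  "vector_holomorphic_on F U \<longleftrightarrow> (\<forall>z\<in>U. \<exists>D. (F has_derivative (\<lambda>h. h *\<^sub>C D)) (at z within U))"

definition reg :: "('a :: complex_normed_vector \<Rightarrow>\<^sub>L 'a) \<Rightarrow> complex set" where
  "reg T = {z. \<exists>U F. open U \<and> z \<in> U \<and> F ` U \<subseteq> clinear_ops \<and> vector_holomorphic_on F U \<and>
     (\<forall>\<mu>\<in>U. (\<mu> *\<^sub>C id_blinfun - T) o\<^sub>L F \<mu> o\<^sub>L (\<mu> *\<^sub>C id_blinfun - T) = \<mu> *\<^sub>C id_blinfun - T \<and>
             F \<mu> o\<^sub>L (\<mu> *\<^sub>C id_blinfun - T) o\<^sub>L F \<mu> = F \<mu>)}"

definition generalized_spectrum :: "('a :: complex_normed_vector \<Rightarrow>\<^sub>L 'a) \<Rightarrow> complex set" where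
  "generalized_spectrum T = UNIV - reg T"

end

theory Submission
  imports Defs "HOL-Complex_Analysis.Complex_Analysis"
begin

text \<open>
  The proof rests on one subspace: the core \<open>M\<close>, the closed span of the kernels of all \<open>\<mu> - T\<close> with
  \<open>\<mu>\<close> regular. Every inner inverse \<open>S\<close> of \<open>\<zeta> - T\<close> at a regular point \<open>\<zeta>\<close> leaves \<open>M\<close> invariant; on \<open>M\<close> it is
  a right inverse of \<open>\<zeta> - T\<close>, and modulo \<open>M\<close> it is a left inverse (\<open>eigen_core_generalized_inverse\<close>).
  So \<open>T\<close> splits into a surjective part on \<open>M\<close> and a part on the quotient that is bounded below, and
  it does so with the same \<open>M\<close> for all regular translates.

  The supremum does not exceed the distance. If \<open>T S T = T\<close> and \<open>\<bar>z\<bar> < 1 / r(S)\<close>, then \<open>1 - z S\<close> is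
  invertible, and \<open>S (1 - z S)^-1\<close> is, up to sign, an inner inverse of \<open>z - T\<close>, because
  \<open>(1 - z S)^-1\<close> maps the kernel of \<open>T\<close> into \<open>M\<close>, where \<open>T S = 1\<close>. It depends holomorphically on
  \<open>z\<close>, so \<open>z\<close> is regular (\<open>inner_inverse_disc_regular\<close>).

  The distance does not exceed the supremum. Let \<open>s < r\<close>, with \<open>r\<close> smaller than the distance. An inner inverse of \<open>T\<close>
  with spectrum in the disc of radius \<open>1 / s\<close> is assembled from two blocks
  (\<open>inner_inverse_with_small_spectrum\<close>). Passing to the adjoint on \<open>M\<close>, both blocks reduce to the same
  problem: an operator \<open>A\<close> on a closed subspace has all its translates \<open>A - z\<close>, \<open>\<bar>z\<bar> \<le> r\<close>,
  uniformly bounded below, and a left inverse of spectral radius at most \<open>1 / s\<close> is wanted. The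
  first half of the solution is the estimate \<open>\<parallel>A^n x\<parallel> \<ge> \<kappa> r^n \<parallel>x\<parallel>\<close> (\<open>bounded_below_powers\<close>). It says that boundedness below on
  the disc makes every orbit grow at the rate of the radius; it comes from Parseval's identity for
  \<open>\<Sum>k. z^(-k) A^k x\<close> and a combinatorial argument on the Newton polygon of the orbit norms. The second
  half is a renorming: for large \<open>K\<close> the equivalent Hilbert norm with square
  \<open>\<Sum>k<K. s^(-2k) \<parallel>A^k x\<parallel>^2\<close> makes \<open>A\<close> expand by \<open>s\<close>, and the left inverse that vanishes on the orthogonal
  complement of the range contracts by \<open>s\<close> (\<open>left_inverse_with_geometric_growth\<close>).
\<close>

section \<open>Hilbert space geometry\<close>

subclass (in complex_hilbert_space) banach ..

lemma cinner_add_right: "cinner x (y + z) = cinner x y + cinner x z"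
  by (metis cinner_add_left cinner_commute complex_cnj_add)

lemma cinner_scaleC_right: "cinner x (a *\<^sub>C y) = cnj a * cinner x y"
  by (metis cinner_commute cinner_scaleC_left complex_cnj_mult)

lemma scaleC_zero_left [simp]: "0 *\<^sub>C (x :: 'a :: complex_vector) = 0"
  by (metis scaleC_add_left add_cancel_left_left)

declare scaleC_one [simp]

lemma cinner_zero [simp]: "cinner 0 y = 0" "cinner y 0 = 0"
  by (metis cinner_scaleC_left scaleC_zero_left mult_zero_left,
      metis cinner_scaleC_right scaleC_zero_left mult_zero_left complex_cnj_zero)

lemma cinner_diff_left: "cinner (x - y) z = cinner x z - cinner y z"
  by (metis cinner_add_left add_diff_cancel_right' diff_add_cancel)

lemma cinner_diff_right: "cinner x (y - z) = cinner x y - cinner x z"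
  by (metis cinner_add_right add_diff_cancel_right' diff_add_cancel)

lemma cinner_sum_left: "cinner (sum f A) y = (\<Sum>a\<in>A. cinner (f a) y)"
  by (induction A rule: infinite_finite_induct) (simp_all add: cinner_add_left)

lemma cinner_sum_right: "cinner y (sum f A) = (\<Sum>a\<in>A. cinner y (f a))"
  by (induction A rule: infinite_finite_induct) (simp_all add: cinner_add_right)

lemma Cauchy_Schwarz_cinner: "cmod (cinner x y) \<le> norm x * norm y"
proof (cases "y = 0")
  case False
  define n where "n = (norm y)\<^sup>2"
  have n: "n > 0" using False by (simp add: n_def)
  define t where "t = cinner x y / of_real n"
  have "complex_of_real ((norm (x - t *\<^sub>C y))\<^sup>2) = cinner (x - t *\<^sub>C y) (x - t *\<^sub>C y)"
    by (simp add: cinner_norm)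
  also have "\<dots> = cinner x x - cnj t * cinner x y - t * cinner y x + t * cnj t * cinner y y"
    by (simp add: cinner_diff_left cinner_diff_right cinner_scaleC_left cinner_scaleC_right
        algebra_simps)
  also have "\<dots> = of_real ((norm x)\<^sup>2) - cinner x y * cnj (cinner x y) / of_real n"
    using n by (simp add: t_def cinner_norm n_def[symmetric] cinner_commute[of y x])
  also have "\<dots> = of_real ((norm x)\<^sup>2 - (cmod (cinner x y))\<^sup>2 / n)"
    by (simp only: complex_norm_square[symmetric] of_real_diff of_real_divide of_real_power)
  finally have "(norm x)\<^sup>2 - (cmod (cinner x y))\<^sup>2 / n = (norm (x - t *\<^sub>C y))\<^sup>2"
    by (simp only: of_real_eq_iff)
  then have "(cmod (cinner x y))\<^sup>2 / n \<le> (norm x)\<^sup>2"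
    by (smt (verit) zero_le_power2)
  then have "(cmod (cinner x y))\<^sup>2 \<le> (norm x * norm y)\<^sup>2"
    using n by (simp add: divide_le_eq power_mult_distrib n_def)
  then show ?thesis
    by (rule power2_le_imp_le) simp
qed simp

lemma bounded_bilinear_cinner: "bounded_bilinear cinner"
  by (rule bounded_bilinear.intro)
    (auto simp: cinner_add_left cinner_add_right scaleR_scaleC cinner_scaleC_left
      cinner_scaleC_right scaleR_conv_of_real intro!: exI[of _ 1] Cauchy_Schwarz_cinner)

lemmas bounded_linear_cinner_left = bounded_bilinear.bounded_linear_left[OF bounded_bilinear_cinner]

lemma cinner_eqI: "(\<And>z. z \<in> N \<Longrightarrow> cinner z x = cinner z y) \<Longrightarrow> x - y \<in> N \<Longrightarrow> x = y"
  by (metis cinner_diff_right cinner_norm eq_iff_diff_eq_0 norm_eq_zero of_real_eq_0_iff power2_eq_iff_nonneg zero_eq_power2)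

text \<open>
  Subspaces are sets rather than types, because the core of an operator and its orthogonal
  complement depend on terms.
\<close>

definition closed_csubspace :: "'a :: complex_normed_vector set \<Rightarrow> bool" where
  "closed_csubspace N \<longleftrightarrow> closed N \<and> 0 \<in> N \<and> (\<forall>x\<in>N. \<forall>y\<in>N. x + y \<in> N) \<and> (\<forall>c. \<forall>x\<in>N. c *\<^sub>C x \<in> N)"

lemma closed_csubspaceD:
  assumes "closed_csubspace N"
  shows "closed N" "0 \<in> N" "x \<in> N \<Longrightarrow> y \<in> N \<Longrightarrow> x + y \<in> N" "x \<in> N \<Longrightarrow> c *\<^sub>C x \<in> N"
    "x \<in> N \<Longrightarrow> y \<in> N \<Longrightarrow> x - y \<in> N" "x \<in> N \<Longrightarrow> r *\<^sub>R x \<in> N"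
proof -
  show "closed N" "0 \<in> N"
    using assms by (auto simp: closed_csubspace_def)
  have add: "x + y \<in> N" if "x \<in> N" "y \<in> N" for x y
    using assms that by (auto simp: closed_csubspace_def)
  have sc: "c *\<^sub>C x \<in> N" if "x \<in> N" for c x
    using assms that by (auto simp: closed_csubspace_def)
  have r: "r *\<^sub>R x \<in> N" if "x \<in> N" for r x
    using sc that by (simp add: scaleR_scaleC)
  show "x \<in> N \<Longrightarrow> y \<in> N \<Longrightarrow> x - y \<in> N"
    using add[of x "(-1) *\<^sub>R y"] r[of y "-1"] by simp
  show "x \<in> N \<Longrightarrow> r *\<^sub>R x \<in> N" by (rule r)
qed (use assms in \<open>auto simp: closed_csubspace_def\<close>)

text \<open>
  The Riesz representation theorem for an equivalent inner product on a closed subspace, by the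
  variational method: \<open>u\<close> minimises \<open>b u u - 2 * f u\<close>. The parallelogram identity of \<open>b\<close> together
  with coercivity makes minimising sequences Cauchy, and the first variation at the minimum is the
  asserted identity.
\<close>

lemma real_form_representation:
  fixes b :: "'a :: banach \<Rightarrow> 'a \<Rightarrow> real"
  assumes b: "bounded_bilinear b" and sym: "\<And>u v. b u v = b v u"
    and N: "closed N" "subspace N"
    and c: "c > 0" and coercive: "\<And>u. u \<in> N \<Longrightarrow> c * (norm u)\<^sup>2 \<le> b u u"
    and f: "bounded_linear f"
  shows "\<exists>u\<in>N. \<forall>v\<in>N. f v = b v u"
proof -
  interpret b: bounded_bilinear b by (rule b)
  interpret f: bounded_linear f by (rule f)
  note alg = b.add_left b.add_right b.diff_left b.diff_right b.scaleR_left b.scaleR_right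
    f.add f.diff f.scaleR
  define phi where "phi u = b u u - 2 * f u" for u
  define I where "I = Inf (phi ` N)"
  have N0: "0 \<in> N" and Nadd: "u + v \<in> N" and Nsc: "r *\<^sub>R u \<in> N" if "u \<in> N" "v \<in> N" for u v r
    using N(2) that by (auto simp: subspace_def)
  obtain K where K: "\<And>x. norm (f x) \<le> norm x * K" using f.bounded by blast
  have low: "phi u \<ge> - K\<^sup>2 / c" if "u \<in> N" for u
  proof -
    have "0 \<le> (c * norm u - K)\<^sup>2 / c" using c by simp
    also have "\<dots> = c * (norm u)\<^sup>2 - 2 * (norm u * K) + K\<^sup>2 / c"
      using c by (simp add: power2_eq_square field_simps)
    also have "\<dots> \<le> b u u - 2 * f u + K\<^sup>2 / c"
      using coercive[OF that] K[of u] by auto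
    finally show ?thesis by (simp add: phi_def)
  qed
  have bdd: "bdd_below (phi ` N)" using low by (auto intro!: bdd_belowI)
  have Ile: "I \<le> phi u" if "u \<in> N" for u
    unfolding I_def using bdd that by (auto intro: cInf_lower)
  have "\<exists>u\<in>N. phi u < I + 1 / real (Suc n)" for n
  proof -
    have "\<exists>y\<in>phi ` N. y < I + 1 / real (Suc n)"
      unfolding I_def by (rule cInf_lessD) (use N0[OF N0 N0] N(2) in \<open>auto simp: subspace_def\<close>)
    then show ?thesis by auto
  qed
  then obtain u where u: "\<And>n. u n \<in> N" "\<And>n. phi (u n) < I + 1 / real (Suc n)" by metis
  \<comment> \<open>the defect in the midpoint convexity of \<open>phi\<close> is exactly the form on the difference\<close>
  have par: "phi x + phi y = 2 * phi ((1/2) *\<^sub>R (x + y)) + (1/2) * b (x - y) (x - y)" for x y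
    by (simp add: phi_def alg sym[of y x] field_simps)
  have dist: "c / 2 * (norm (u m - u n))\<^sup>2 \<le> 1 / real (Suc m) + 1 / real (Suc n)" for m n
  proof -
    have d: "u m - u n \<in> N" using Nadd[of "u m" "(-1) *\<^sub>R u n"] Nsc[of "u n" "u n" "-1"] u by simp
    have "c / 2 * (norm (u m - u n))\<^sup>2 \<le> (1/2) * b (u m - u n) (u m - u n)"
      using coercive[OF d] by simp
    also have "\<dots> \<le> phi (u m) + phi (u n) - 2 * I"
      using par[of "u m" "u n"] Ile[OF Nsc[OF Nadd[OF u(1)[of m] u(1)[of n]] u(1), of "1/2"]] by simp
    also have "\<dots> \<le> 1 / real (Suc m) + 1 / real (Suc n)"
      using u(2)[of m] u(2)[of n] by auto
    finally show ?thesis .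
  qed
  have "Cauchy u"
  proof (rule metric_CauchyI)
    fix e :: real assume e: "e > 0"
    obtain M where M: "4 / (c * e\<^sup>2) < real M" using reals_Archimedean2 by blast
    have "norm (u m - u n) < e" if "m \<ge> M" "n \<ge> M" for m n
    proof -
      have "0 < 4 / (c * e\<^sup>2)" using c e by simp
      then have Mp: "0 < real M" using M by linarith
      have "1 / real (Suc m) \<le> 1 / real M" "1 / real (Suc n) \<le> 1 / real M"
        using that Mp by (auto intro!: divide_left_mono)
      then have "c / 2 * (norm (u m - u n))\<^sup>2 \<le> 2 / real M"
        using dist[of m n] by linarith
      also have "\<dots> < c / 2 * e\<^sup>2"
        using M Mp c e by (simp add: field_simps)
      finally have "(norm (u m - u n))\<^sup>2 < e\<^sup>2" using c by simp
      then show ?thesis using e by (simp add: power_less_imp_less_base)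
    qed
    then show "\<exists>M. \<forall>m\<ge>M. \<forall>n\<ge>M. dist (u m) (u n) < e" by (auto simp: dist_norm)
  qed
  then obtain w where w: "u \<longlonglongrightarrow> w" using Cauchy_convergent convergent_def by blast
  have wN: "w \<in> N" using N(1) u(1) w closed_sequentially by blast
  have lim: "(\<lambda>n. phi (u n)) \<longlonglongrightarrow> phi w"
    unfolding phi_def by (intro tendsto_intros b.tendsto f.tendsto w)
  have "(\<lambda>n. I + 1 / real (Suc n)) \<longlonglongrightarrow> I + 0"
    by (intro tendsto_intros) (use LIMSEQ_inverse_real_of_nat in \<open>simp add: inverse_eq_divide\<close>)
  then have min: "phi w \<le> I"
    using LIMSEQ_le[OF lim, of "\<lambda>n. I + 1 / real (Suc n)" "I + 0"] u(2) by (auto intro: less_imp_le)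
  have "f v = b v w" if v: "v \<in> N" for v
  proof -
    define g where "g = b v w - f v"
    have q: "0 \<le> t\<^sup>2 * b v v + 2 * t * g" for t
    proof -
      have "phi w \<le> phi (w + t *\<^sub>R v)"
        using min Ile[of "w + t *\<^sub>R v"] Nadd[OF wN Nsc[OF v v]] by auto
      also have "\<dots> = phi w + t\<^sup>2 * b v v + 2 * t * g"
        by (simp add: phi_def alg sym[of w v] g_def algebra_simps power2_eq_square)
      finally show ?thesis by simp
    qed
    have bvv: "b v v \<ge> 0" using coercive[OF v] c by (smt (verit) mult_nonneg_nonneg zero_le_power2)
    \<comment> \<open>the summand 1 keeps the step size defined when \<open>b v v\<close> vanishes\<close>
    have "0 \<le> (- g / (b v v + 1))\<^sup>2 * b v v + 2 * (- g / (b v v + 1)) * g" by (rule q)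
    also have "\<dots> = - (g\<^sup>2 * ((b v v + 2) / (b v v + 1)\<^sup>2))"
      using bvv by (simp add: divide_simps) (simp add: algebra_simps power2_eq_square)
    finally have "g\<^sup>2 * ((b v v + 2) / (b v v + 1)\<^sup>2) \<le> 0" by simp
    moreover have "(b v v + 2) / (b v v + 1)\<^sup>2 > 0" using bvv by simp
    ultimately have "g\<^sup>2 \<le> 0" by (metis mult_le_0_iff not_le)
    then have "g = 0" by simp
    then show ?thesis by (simp add: g_def)
  qed
  then show ?thesis using wN by blast
qed

text \<open>
  This one statement supplies the orthogonal projections and the adjoints, with \<open>B\<close> the inner
  product, and the projections that are orthogonal for an equivalent inner product. The real parts
  of both sides agree by the real case; replacing \<open>v\<close> by \<open>\<i> v\<close> makes the imaginary parts agree.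
\<close>

lemma form_representation:
  fixes B :: "'a :: complex_hilbert_space \<Rightarrow> 'a \<Rightarrow> complex"
  assumes B: "bounded_bilinear B" and herm: "\<And>u v. B u v = cnj (B v u)"
    and lin: "\<And>a u v. B (a *\<^sub>C u) v = a * B u v"
    and N: "closed_csubspace N"
    and c: "c > 0" and coercive: "\<And>u. u \<in> N \<Longrightarrow> c * (norm u)\<^sup>2 \<le> Re (B u u)"
    and f: "bounded_linear f" "\<And>a v. f (a *\<^sub>C v) = a * f v"
  shows "\<exists>u\<in>N. \<forall>v\<in>N. f v = B v u"
proof -
  interpret B: bounded_bilinear B by (rule B)
  obtain K where K: "\<And>a b. norm (B a b) \<le> norm a * norm b * K" using B.bounded by blast
  have "bounded_bilinear (\<lambda>u v. Re (B u v))"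
    by (rule bounded_bilinear.intro)
      (auto simp: B.add_left B.add_right B.scaleR_left B.scaleR_right
        intro!: exI[of _ K] order_trans[OF abs_Re_le_cmod K])
  moreover have "subspace N" using closed_csubspaceD[OF N] by (auto simp: subspace_def)
  moreover have "Re (B u v) = Re (B v u)" for u v by (subst herm) simp
  ultimately obtain u where u: "u \<in> N" "\<And>v. v \<in> N \<Longrightarrow> Re (f v) = Re (B v u)"
    using real_form_representation[of "\<lambda>u v. Re (B u v)" N c "\<lambda>v. Re (f v)"]
      closed_csubspaceD(1)[OF N] c coercive bounded_linear_compose[OF bounded_linear_Re f(1)] by blast
  have "f v = B v u" if "v \<in> N" for v
    using u(2)[OF that] u(2)[OF closed_csubspaceD(4)[OF N that, of "\<i>"]]
    by (simp add: f(2) lin complex_eq_iff)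
  then show ?thesis using u(1) by blast
qed

section \<open>The algebra of complex-linear operators\<close>

lemma clinear_opsD: "A \<in> clinear_ops \<Longrightarrow> blinfun_apply A (c *\<^sub>C x) = c *\<^sub>C blinfun_apply A x"
  by (simp add: clinear_ops_def)

lemma scaleC_diff_right: "a *\<^sub>C (x - y :: 'a :: complex_vector) = a *\<^sub>C x - a *\<^sub>C y"
  by (metis scaleC_add_right add_diff_cancel_right' diff_add_cancel)

lemma scaleC_diff_left: "(a - b) *\<^sub>C (x :: 'a :: complex_vector) = a *\<^sub>C x - b *\<^sub>C x"
  by (metis scaleC_add_left add_diff_cancel_right' diff_add_cancel)

lemma scaleC_zero_right [simp]: "a *\<^sub>C (0 :: 'a :: complex_vector) = 0"
  using scaleC_diff_right[of a 0 "0 :: 'a"] by simp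

lemma scaleC_minus_right: "a *\<^sub>C (- x :: 'a :: complex_vector) = - (a *\<^sub>C x)"
  using scaleC_diff_right[of a 0 x] by simp

lemma scaleC_minus_left: "(- a) *\<^sub>C (x :: 'a :: complex_vector) = - (a *\<^sub>C x)"
  using scaleC_diff_left[of 0 a x] by simp

lemmas scaleC_alg = scaleC_add_right scaleC_add_left scaleC_diff_right scaleC_diff_left
  scaleC_scaleC scaleC_minus_right scaleC_minus_left

lemmas bl_simps = blinfun.add_left blinfun.add_right blinfun.diff_left blinfun.diff_right
  blinfun.minus_left blinfun.minus_right blinfun.zero_left blinfun.zero_right scaleC_blinfun.rep_eq

lemma blinfun_eq_iff: "A = B \<longleftrightarrow> (\<forall>x. blinfun_apply A x = blinfun_apply B x)"
  by (auto intro: blinfun_eqI)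

lemma clinear_ops_intros:
  "id_blinfun \<in> clinear_ops" "0 \<in> clinear_ops"
  "A \<in> clinear_ops \<Longrightarrow> B \<in> clinear_ops \<Longrightarrow> A + B \<in> clinear_ops"
  "A \<in> clinear_ops \<Longrightarrow> B \<in> clinear_ops \<Longrightarrow> A - B \<in> clinear_ops"
  "A \<in> clinear_ops \<Longrightarrow> - A \<in> clinear_ops"
  "A \<in> clinear_ops \<Longrightarrow> c *\<^sub>C A \<in> clinear_ops"
  "A \<in> clinear_ops \<Longrightarrow> B \<in> clinear_ops \<Longrightarrow> A o\<^sub>L B \<in> clinear_ops"
  by (auto simp: clinear_ops_def bl_simps scaleC_alg mult.commute)

lemma clinear_op_exists:
  fixes f :: "'a :: complex_normed_vector \<Rightarrow> 'a"
  assumes "\<And>x y. f (x + y) = f x + f y" "\<And>c x. f (c *\<^sub>C x) = c *\<^sub>C f x"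
    "\<And>x. norm (f x) \<le> norm x * K"
  shows "\<exists>A\<in>clinear_ops. blinfun_apply A = f"
proof -
  have "bounded_linear f"
    by (rule bounded_linear_intro[where K = K]) (use assms in \<open>auto simp: scaleR_scaleC\<close>)
  then have "blinfun_apply (Blinfun f) = f" by (rule bounded_linear_Blinfun_apply)
  then show ?thesis using assms(2) by (intro bexI[of _ "Blinfun f"]) (auto simp: clinear_ops_def)
qed

primrec op_power :: "('a :: real_normed_vector \<Rightarrow>\<^sub>L 'a) \<Rightarrow> nat \<Rightarrow> 'a \<Rightarrow>\<^sub>L 'a" where
  "op_power A 0 = id_blinfun"
| "op_power A (Suc n) = A o\<^sub>L op_power A n"

lemma op_power_Suc_apply:
  "blinfun_apply (op_power A n) (blinfun_apply A x) = blinfun_apply A (blinfun_apply (op_power A n) x)"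
  by (induction n) simp_all

lemma op_power_mono:
  fixes A :: "'a :: real_normed_vector \<Rightarrow>\<^sub>L 'a"
  assumes "A ` N \<subseteq> N" "x \<in> N"
  shows "op_power A n x \<in> N"
  using assms by (induction n) auto

lemma op_power_clinear: "A \<in> clinear_ops \<Longrightarrow> op_power A n \<in> clinear_ops"
  by (induction n) (auto intro: clinear_ops_intros)

definition op_invertible :: "('a :: complex_normed_vector \<Rightarrow>\<^sub>L 'a) \<Rightarrow> bool" where
  "op_invertible A \<longleftrightarrow> (\<exists>B\<in>clinear_ops. A o\<^sub>L B = id_blinfun \<and> B o\<^sub>L A = id_blinfun)"

lemma op_spectrum_iff: "z \<in> op_spectrum A \<longleftrightarrow> \<not> op_invertible (z *\<^sub>C id_blinfun - A)"
  by (simp add: op_spectrum_def op_invertible_def)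

lemma op_invertible_compose:
  assumes "op_invertible A" "op_invertible B"
  shows "op_invertible (A o\<^sub>L B)"
proof -
  obtain A' B' where "A' \<in> clinear_ops" "A o\<^sub>L A' = id_blinfun" "A' o\<^sub>L A = id_blinfun"
    "B' \<in> clinear_ops" "B o\<^sub>L B' = id_blinfun" "B' o\<^sub>L B = id_blinfun"
    using assms by (auto simp: op_invertible_def)
  then show ?thesis unfolding op_invertible_def
    by (intro bexI[of _ "B' o\<^sub>L A'"])
      (simp_all add: clinear_ops_intros blinfun_eq_iff)
qed

lemma op_invertible_scaleC:
  assumes "op_invertible A" "c \<noteq> 0"
  shows "op_invertible (c *\<^sub>C A)"
proof -
  obtain B where B: "B \<in> clinear_ops" "A o\<^sub>L B = id_blinfun" "B o\<^sub>L A = id_blinfun"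
    using assms by (auto simp: op_invertible_def)
  have "blinfun_apply A ((inverse c) *\<^sub>C x) = inverse c *\<^sub>C A x" for x :: 'a
  proof -
    have "inverse c *\<^sub>C x = B (inverse c *\<^sub>C A x)"
      using B by (simp add: clinear_opsD blinfun_eq_iff)
    then show ?thesis using B(2) by (metis blinfun_apply_blinfun_compose blinfun_apply_id_blinfun id_apply)
  qed
  then show ?thesis using B assms(2) unfolding op_invertible_def
    by (intro bexI[of _ "inverse c *\<^sub>C B"])
      (simp_all add: clinear_ops_intros blinfun_eq_iff bl_simps scaleC_alg clinear_opsD)
qed

text \<open>
  The geometric series of \<open>- A\<close> stops after its second term.
\<close>

lemma op_invertible_nilpotent:
  assumes "A \<in> clinear_ops" "A o\<^sub>L A = 0"
  shows "op_invertible (id_blinfun + A)"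
  unfolding op_invertible_def using assms
  by (intro bexI[of _ "id_blinfun - A"])
    (simp_all add: clinear_ops_intros blinfun_eq_iff bl_simps)

text \<open>
  The half of the spectral radius formula that is needed to confine a spectrum: the Neumann series
  \<open>\<Sum>n. E^n / z^(n+1)\<close> converges as soon as the powers of \<open>E\<close> grow more slowly than those of \<open>z\<close>. The
  constant \<open>C\<close> does not influence the radius, which is what permits a change to an equivalent norm.
\<close>

lemma op_invertible_if_geometric_growth:
  fixes E :: "'a :: complex_hilbert_space \<Rightarrow>\<^sub>L 'a"
  assumes E: "E \<in> clinear_ops" and rho: "0 \<le> \<rho>" "\<rho> < cmod z"
    and growth: "\<And>n (x :: 'a). norm (op_power E n x) \<le> C * \<rho> ^ n * norm x"
  shows "op_invertible (z *\<^sub>C id_blinfun - E)"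
proof -
  have z: "z \<noteq> 0" using rho by auto
  have C: "0 \<le> \<bar>C\<bar> * \<rho> ^ n" for n using rho by simp
  define a where "a n = inverse z ^ n *\<^sub>C op_power E n" for n
  define f where "f n = inverse z *\<^sub>C a n" for n
  have na: "norm (a n) \<le> \<bar>C\<bar> * (\<rho> / cmod z) ^ n" for n
  proof -
    have "norm (op_power E n) \<le> \<bar>C\<bar> * \<rho> ^ n"
    proof (rule norm_blinfun_bound[OF C])
      fix x :: 'a
      have "C * (\<rho> ^ n * norm x) \<le> \<bar>C\<bar> * (\<rho> ^ n * norm x)"
        using rho by (intro mult_right_mono) auto
      then show "norm (op_power E n x) \<le> \<bar>C\<bar> * \<rho> ^ n * norm x"
        using growth[of n x] by (simp add: mult.assoc)
    qed
    then show ?thesis using z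
      by (simp add: a_def norm_scaleC norm_power norm_inverse norm_divide power_divide field_simps)
  qed
  have lt: "norm (\<rho> / cmod z) < 1" using rho z by simp
  have sm: "summable (\<lambda>n. \<bar>C\<bar> * (\<rho> / cmod z) ^ n)"
    using lt by (intro summable_mult summable_geometric)
  have suma: "summable a" by (rule summable_comparison_test'[OF sm]) (rule na)
  have sumf: "summable f" unfolding f_def
    by (rule bounded_linear.summable[OF bounded_linear_scaleC suma])
  have lim: "a \<longlonglongrightarrow> 0" using suma by (rule summable_LIMSEQ_zero)
  define R where "R = suminf f"
  have tele: "(\<lambda>n. a n - a (Suc n)) sums (a 0 - 0)"
    by (rule telescope_sums'[OF lim])
  have step: "(z *\<^sub>C id_blinfun - E) o\<^sub>L f n = a n - a (Suc n)" "f n o\<^sub>L (z *\<^sub>C id_blinfun - E) = a n - a (Suc n)" for n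
    using z E by (auto simp: f_def a_def blinfun_eq_iff bl_simps scaleC_alg clinear_opsD op_power_clinear op_power_Suc_apply mult.assoc)
  have "(\<lambda>n. (z *\<^sub>C id_blinfun - E) o\<^sub>L f n) sums ((z *\<^sub>C id_blinfun - E) o\<^sub>L R)"
    unfolding R_def by (rule bounded_linear.sums[OF bounded_bilinear.bounded_linear_right[OF bounded_bilinear_blinfun_compose] summable_sums[OF sumf]])
  then have 1: "(z *\<^sub>C id_blinfun - E) o\<^sub>L R = id_blinfun"
    using tele sums_unique2 by (fastforce simp: step a_def)
  have "(\<lambda>n. f n o\<^sub>L (z *\<^sub>C id_blinfun - E)) sums (R o\<^sub>L (z *\<^sub>C id_blinfun - E))"
    unfolding R_def by (rule bounded_linear.sums[OF bounded_bilinear.bounded_linear_left[OF bounded_bilinear_blinfun_compose] summable_sums[OF sumf]])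
  then have 2: "R o\<^sub>L (z *\<^sub>C id_blinfun - E) = id_blinfun"
    using tele sums_unique2 by (fastforce simp: step a_def)
  have "R \<in> clinear_ops"
  proof -
    \<comment> \<open>a two-sided inverse of a complex-linear operator is complex-linear\<close>
    have "R (c *\<^sub>C x) = c *\<^sub>C R x" for c and x :: 'a
    proof -
      let ?J = "z *\<^sub>C id_blinfun - E"
      have J: "?J \<in> clinear_ops" using E by (intro clinear_ops_intros)
      have "R (c *\<^sub>C x) = R (c *\<^sub>C ?J (R x))" using 1 by (simp add: blinfun_eq_iff)
      also have "\<dots> = R (?J (c *\<^sub>C R x))" using clinear_opsD[OF J] by metis
      also have "\<dots> = c *\<^sub>C R x" using 2 by (metis blinfun_apply_blinfun_compose blinfun_apply_id_blinfun id_apply)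
      finally show ?thesis .
    qed
    then show ?thesis by (simp add: clinear_ops_def)
  qed
  then show ?thesis using 1 2 by (auto simp: op_invertible_def)
qed

lemma orthogonal_projection_exists:
  fixes N :: "'a :: complex_hilbert_space set"
  assumes N: "closed_csubspace N"
  shows "\<exists>P\<in>clinear_ops. (\<forall>x. P x \<in> N) \<and> (\<forall>x\<in>N. P x = x) \<and> (\<forall>x y. cinner (P x) y = cinner x (P y))"
proof -
  note Ns = closed_csubspaceD[OF N]
  have "\<exists>u\<in>N. \<forall>v\<in>N. cinner v y = cinner v u" for y :: 'a
    by (rule form_representation[of cinner N 1 "\<lambda>v. cinner v y"])
      (use N in \<open>auto simp: bounded_bilinear_cinner bounded_linear_cinner_left cinner_scaleC_left
         cinner_norm intro: cinner_commute\<close>)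
  then obtain p where p: "\<And>y. p y \<in> N" "\<And>v y. v \<in> N \<Longrightarrow> cinner v (p y) = cinner v y" by metis
  have eq: "p y = u" if "u \<in> N" "\<And>v. v \<in> N \<Longrightarrow> cinner v y = cinner v u" for y u
    by (rule cinner_eqI[of N]) (use p that Ns in auto)
  have add: "p (x + y) = p x + p y" for x y
    by (rule eq) (use p Ns in \<open>auto simp: cinner_add_right\<close>)
  have sc: "p (c *\<^sub>C x) = c *\<^sub>C p x" for c x
    by (rule eq) (use p Ns in \<open>auto simp: cinner_scaleC_right\<close>)
  have sym: "cinner (p x) y = cinner x (p y)" for x y
    by (metis p cinner_commute)
  have bd: "norm (p x) \<le> norm x * 1" for x
  proof -
    have "(norm (p x))\<^sup>2 = cmod (cinner (p x) (p x))"
      by (simp only: cinner_norm norm_of_real) simp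
    also have "\<dots> = cmod (cinner (p x) x)" using p by simp
    also have "\<dots> \<le> norm (p x) * norm x" by (rule Cauchy_Schwarz_cinner)
    finally show ?thesis by (simp add: power2_eq_square mult_le_cancel_left_pos)
        (metis mult_le_cancel_left_pos norm_ge_zero zero_less_norm_iff norm_zero)
  qed
  obtain P where "P \<in> clinear_ops" "blinfun_apply P = p"
    using clinear_op_exists[of p, OF add sc bd] by blast
  then show ?thesis using p eq sym by (intro bexI[of _ P]) auto
qed

lemma adjoint_exists:
  fixes A :: "'a :: complex_hilbert_space \<Rightarrow>\<^sub>L 'a"
  assumes A: "A \<in> clinear_ops"
  shows "\<exists>B\<in>clinear_ops. \<forall>x y. cinner (A x) y = cinner x (B y)"
proof -
  have UN: "closed_csubspace (UNIV :: 'a set)" by (simp add: closed_csubspace_def)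
  have "\<exists>u\<in>UNIV. \<forall>v\<in>UNIV. cinner (A v) y = cinner v u" for y :: 'a
    by (rule form_representation[of cinner UNIV 1 "\<lambda>v. cinner (A v) y"])
      (use UN A in \<open>auto simp: bounded_bilinear_cinner cinner_scaleC_left clinear_opsD
         cinner_norm intro: cinner_commute bounded_linear_compose[OF bounded_linear_cinner_left blinfun.bounded_linear_right]\<close>)
  then obtain b where b: "\<And>v y. cinner (A v) y = cinner v (b y)" by (metis UNIV_I)
  have eq: "b y = u" if "\<And>v. cinner (A v) y = cinner v u" for y u
    by (rule cinner_eqI[of UNIV]) (use b that in auto)
  have add: "b (x + y) = b x + b y" for x y
    by (rule eq) (use b in \<open>auto simp: cinner_add_right\<close>)
  have sc: "b (c *\<^sub>C x) = c *\<^sub>C b x" for c x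
    by (rule eq) (use b in \<open>auto simp: cinner_scaleC_right\<close>)
  have bd: "norm (b x) \<le> norm x * norm A" for x
  proof -
    have "(norm (b x))\<^sup>2 = cmod (cinner (b x) (b x))"
      by (simp only: cinner_norm norm_of_real) simp
    also have "\<dots> = cmod (cinner (A (b x)) x)" using b by simp
    also have "\<dots> \<le> norm (A (b x)) * norm x" by (rule Cauchy_Schwarz_cinner)
    also have "\<dots> \<le> (norm A * norm (b x)) * norm x" by (intro mult_right_mono norm_blinfun) simp
    finally have "norm (b x) * norm (b x) \<le> norm (b x) * (norm x * norm A)"
      by (simp add: power2_eq_square mult.commute mult.left_commute)
    then show ?thesis
      by (metis mult_le_cancel_left_pos norm_ge_zero zero_less_norm_iff norm_zero mult_nonneg_nonneg)
  qed
  obtain B where "B \<in> clinear_ops" "blinfun_apply B = b"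
    using clinear_op_exists[of b, OF add sc bd] by blast
  then show ?thesis using b by (intro bexI[of _ B]) auto
qed

section \<open>Growth of the powers of an operator whose translates are bounded below\<close>

text \<open>
  Parseval's identity for vector-valued polynomials, with the mean over the circle replaced by the
  mean over the \<open>n\<close>-th roots of unity, so that no integration is involved.
\<close>

lemma discrete_Parseval:
  fixes v :: "nat \<Rightarrow> 'a :: complex_inner"
  assumes n: "n > 0"
  defines "e \<equiv> \<lambda>k. exp (2 * of_real pi * \<i> * of_nat k / of_nat n)"
  shows "(\<Sum>j<n. (norm (\<Sum>k<n. e j ^ k *\<^sub>C v k))\<^sup>2) = real n * (\<Sum>k<n. (norm (v k))\<^sup>2)"
proof -
  have nz: "e k \<noteq> 0" for k by (simp add: e_def)
  have cnj_e: "cnj (e k) = inverse (e k)" for k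
  proof -
    have "e k * cnj (e k) = 1"
      by (simp add: complex_norm_square[symmetric] e_def)
    then show ?thesis by (metis inverse_unique)
  qed
  have comm: "e j ^ k = e k ^ j" for j k
    by (simp add: e_def exp_of_nat_mult[symmetric] mult_ac)
  have orth: "(\<Sum>j<n. e j ^ k * cnj (e j ^ l)) = (if k = l then of_nat n else 0)"
    if "k < n" "l < n" for k l
  proof -
    have eq: "e j ^ k * cnj (e j ^ l) = (e k / e l) ^ j" for j
      by (simp add: comm[of j] cnj_e power_mult_distrib power_inverse divide_inverse)
    show ?thesis
    proof (cases "k = l")
      case True
      then show ?thesis unfolding eq using nz by simp
    next
      case False
      have "e k \<noteq> e l"
        using complex_root_unity_eq[of n k l] False that n unfolding e_def
        by (auto simp: cong_def)
      then have ne: "e k / e l \<noteq> 1" using nz by auto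
      have en: "e k ^ n = 1" for k
        using n by (simp add: e_def exp_of_nat_mult[symmetric] mult_ac)
      have "(e k / e l) ^ n = 1" using en by (simp add: power_divide)
      then show ?thesis unfolding eq using ne False by (simp add: geometric_sum)
    qed
  qed
  have "complex_of_real (\<Sum>j<n. (norm (\<Sum>k<n. e j ^ k *\<^sub>C v k))\<^sup>2)
      = (\<Sum>j<n. cinner (\<Sum>k<n. e j ^ k *\<^sub>C v k) (\<Sum>k<n. e j ^ k *\<^sub>C v k))"
    by (simp only: of_real_sum cinner_norm)
  also have "\<dots> = (\<Sum>j<n. \<Sum>k<n. \<Sum>l<n. (e j ^ k * cnj (e j ^ l)) * cinner (v k) (v l))"
    by (simp add: cinner_sum_left cinner_sum_right cinner_scaleC_left
        cinner_scaleC_right mult.assoc sum_distrib_left)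
      (rule sum.cong[OF refl], subst sum.swap, simp add: mult_ac)
  also have "\<dots> = (\<Sum>k<n. \<Sum>l<n. (\<Sum>j<n. e j ^ k * cnj (e j ^ l)) * cinner (v k) (v l))"
    by (subst sum.swap, rule sum.cong[OF refl], subst sum.swap) (simp add: sum_distrib_right)
  also have "\<dots> = (\<Sum>k<n. \<Sum>l<n. if k = l then of_nat n * cinner (v k) (v l) else 0)"
    by (intro sum.cong refl) (simp add: orth del: complex_cnj_power)
  also have "\<dots> = complex_of_real (real n * (\<Sum>k<n. (norm (v k))\<^sup>2))"
    by (simp add: cinner_norm sum_distrib_left)
  finally show ?thesis by (simp only: of_real_eq_iff)
qed

text \<open>
  For \<open>p z = (\<Sum>k<n. z^(-k) A^k x)\<close> the sum \<open>(A - z) (p z)\<close> telescopes to \<open>z (z^(-n) A^n x - x)\<close>,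
  which on the circle of radius \<open>\<rho>\<close> is controlled by the two ends of the orbit alone. Boundedness
  below therefore bounds \<open>p\<close> on the circle, and Parseval's identity turns this into a bound for the
  sum of squares of all its coefficients.
\<close>

lemma orbit_square_sum_bound:
  fixes A :: "'a :: complex_inner \<Rightarrow>\<^sub>L 'a"
  assumes A: "A \<in> clinear_ops" and inv: "A ` N \<subseteq> N" and N: "closed_csubspace N"
    and c: "c > 0" and below: "\<And>x z. x \<in> N \<Longrightarrow> cmod z = \<rho> \<Longrightarrow> c * norm x \<le> norm (A x - z *\<^sub>C x)"
    and x: "x \<in> N" and rho: "\<rho> > 0"
  shows "c\<^sup>2 * (\<Sum>k<n. (norm (op_power A k x) / \<rho> ^ k)\<^sup>2)
    \<le> \<rho>\<^sup>2 * (norm (op_power A n x) / \<rho> ^ n + norm x)\<^sup>2"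
proof (cases "n = 0")
  case False
  define e where "e k = exp (2 * of_real pi * \<i> * of_nat k / of_nat n)" for k :: nat
  define v where "v k = (complex_of_real (inverse \<rho>) ^ k) *\<^sub>C op_power A k x" for k
  define B where "B = norm (op_power A n x) / \<rho> ^ n + norm x"
  have nv: "norm (v k) = norm (op_power A k x) / \<rho> ^ k" for k
    using rho by (simp add: v_def norm_scaleC norm_power norm_inverse divide_inverse power_inverse mult.commute)
  have bound: "c * norm (\<Sum>k<n. e j ^ k *\<^sub>C v k) \<le> \<rho> * B" for j
  proof -
    define z where "z = of_real \<rho> * inverse (e j)"
    have e1: "cmod (e j) = 1" by (simp add: e_def)
    have z: "cmod z = \<rho>" "z \<noteq> 0" using rho e1 by (auto simp: z_def norm_mult norm_inverse e_def)
    define w where "w k = inverse z ^ k *\<^sub>C op_power A k x" for k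
    have ew: "e j ^ k *\<^sub>C v k = w k" for k
      using rho by (simp add: w_def v_def z_def scaleC_scaleC power_mult_distrib[symmetric] mult.commute)
    have wN: "w k \<in> N" for k unfolding w_def
      by (intro closed_csubspaceD(4)[OF N] op_power_mono[OF inv x])
    have step: "A (w k) - z *\<^sub>C w k = z *\<^sub>C (w (Suc k) - w k)" for k
      using z A by (simp add: w_def clinear_opsD scaleC_alg)
    have sumN: "(\<Sum>k<n. w k) \<in> N"
      by (induction n) (use wN closed_csubspaceD[OF N] in auto)
    have "A (\<Sum>k<n. w k) - z *\<^sub>C (\<Sum>k<n. w k) = (\<Sum>k<n. A (w k) - z *\<^sub>C w k)"
      by (simp add: blinfun.sum_right sum_subtractf linear_sum[OF bounded_linear.linear[OF bounded_linear_scaleC]])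
    also have "\<dots> = z *\<^sub>C (\<Sum>k<n. w (Suc k) - w k)"
      by (simp add: step linear_sum[OF bounded_linear.linear[OF bounded_linear_scaleC]])
    also have "\<dots> = z *\<^sub>C (w n - w 0)" by (simp add: sum_lessThan_telescope)
    finally have "c * norm (\<Sum>k<n. w k) \<le> norm (z *\<^sub>C (w n - w 0))"
      using below[OF sumN z(1)] by simp
    also have "\<dots> \<le> \<rho> * (norm (w n) + norm (w 0))"
      using rho by (simp add: norm_scaleC z norm_triangle_ineq4)
    also have "norm (w n) = norm (op_power A n x) / \<rho> ^ n"
      using z by (simp add: w_def norm_scaleC norm_power norm_inverse divide_inverse power_inverse mult.commute)
    also have "norm (w 0) = norm x" by (simp add: w_def)
    finally show ?thesis by (simp add: ew B_def)
  qed
  have "c\<^sup>2 * (real n * (\<Sum>k<n. (norm (v k))\<^sup>2)) = (\<Sum>j<n. (c * norm (\<Sum>k<n. e j ^ k *\<^sub>C v k))\<^sup>2)"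
    using discrete_Parseval[of n v] False
    by (simp only: e_def power_mult_distrib sum_distrib_left[symmetric])
  also have "\<dots> \<le> (\<Sum>j<n. (\<rho> * B)\<^sup>2)"
    using c bound by (intro sum_mono power_mono) auto
  finally have "real n * (c\<^sup>2 * (\<Sum>k<n. (norm (v k))\<^sup>2)) \<le> real n * (\<rho>\<^sup>2 * B\<^sup>2)"
    by (simp add: power_mult_distrib mult_ac)
  then show ?thesis using False by (simp add: nv B_def)
qed simp

text \<open>
  The property of the scaled orbit norms \<open>\<alpha> k\<close> that the preceding bound yields. It says that none of
  the sequences \<open>\<alpha> k / \<sigma>^k\<close> can stay near one value for long: a long stretch would make the left
  side large while the right side sees only the two ends.
\<close>

definition resists_flatness :: "real \<Rightarrow> real \<Rightarrow> (nat \<Rightarrow> real) \<Rightarrow> bool" where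
  "resists_flatness e C \<alpha> \<longleftrightarrow> (\<forall>k. 0 \<le> \<alpha> k) \<and> (\<forall>k. e * \<alpha> k \<le> \<alpha> (Suc k)) \<and>
    (\<forall>\<sigma> m n. 0 < \<sigma> \<longrightarrow> \<sigma> \<le> 1 \<longrightarrow>
      (\<Sum>k<n. (\<alpha> (m + k) / \<sigma> ^ k)\<^sup>2) \<le> C * (\<alpha> (m + n) / \<sigma> ^ n + \<alpha> m)\<^sup>2)"

text \<open>
  The radius \<open>\<sigma>\<close> runs through a geometric grid from \<open>e\<close> up to 1. At \<open>\<sigma> = e\<close> the first term of
  \<open>\<alpha> k / \<sigma>^k\<close> is minimal. When \<open>\<sigma>\<close> increases by the factor \<open>q\<close>, the place of the minimum cannot move
  right by more than \<open>M\<close> steps, because between the old and the new minimum the sequence is almost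
  flat at its minimal level. Since the grid has \<open>J\<close> steps, the minimum of \<open>\<alpha>\<close> itself lies among the
  first \<open>J * M\<close> terms, where \<open>\<alpha>\<close> can have decreased only by a bounded factor. In geometric
  terms: the Newton polygon of \<open>ln \<alpha>\<close> has a bounded number of edges of negative slope, each of bounded
  length.
\<close>

lemma no_initial_decay:
  fixes C e :: real
  assumes C: "C \<ge> 0" and e: "0 < e" "e \<le> 1"
  shows "\<exists>\<kappa>>0. \<forall>\<alpha> n. resists_flatness e C \<alpha> \<longrightarrow> \<kappa> * \<alpha> 0 \<le> \<alpha> n"
proof -
  \<comment> \<open>a stretch of \<open>M\<close> terms, each of square at least half the minimal one, outweighs \<open>C\<close> times the square of twice the minimum\<close>
  obtain M where M: "8 * C < real M" using reals_Archimedean2 by blast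
  then have Mpos: "M > 0" using C by (cases M) auto
  define q where "q = root (2 * M) (2::real)"
  have q1: "q > 1" using Mpos by (simp add: q_def)
  have qM: "q ^ (2 * M) = 2" using Mpos by (simp add: q_def)
  define s where "s j = min 1 (e * q ^ j)" for j
  have s: "0 < s j" "s j \<le> 1" "s j \<le> s (Suc j)" "s (Suc j) \<le> q * s j" for j
  proof -
    have p: "q ^ j > 0" using q1 by simp
    show "0 < s j" using e p by (simp add: s_def)
    show "s j \<le> 1" by (simp add: s_def)
    have "e * q ^ j \<le> e * q ^ Suc j" using q1 e p by simp
    then show "s j \<le> s (Suc j)" by (auto simp: s_def)
    show "s (Suc j) \<le> q * s j" using q1 by (simp add: s_def min_mult_distrib_left mult_ac)
  qed
  obtain J where "1 / e < q ^ J" using real_arch_pow[OF q1] by blast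
  then have sJ: "s J = 1" using e by (simp add: s_def field_simps min_def)
  have main: "e ^ (J * M) * \<alpha> 0 \<le> \<alpha> n"
    if flat: "resists_flatness e C \<alpha>" for \<alpha> n
  proof -
    have nonneg: "0 \<le> \<alpha> k" and grow: "e * \<alpha> k \<le> \<alpha> (Suc k)" for k
      using flat by (auto simp: resists_flatness_def)
    have sq: "(\<Sum>k<n. (\<alpha> (m + k) / \<sigma> ^ k)\<^sup>2) \<le> C * (\<alpha> (m + n) / \<sigma> ^ n + \<alpha> m)\<^sup>2"
      if "0 < \<sigma>" "\<sigma> \<le> 1" for \<sigma> m n
      using flat that by (auto simp: resists_flatness_def)
    have geo: "e ^ k * \<alpha> 0 \<le> \<alpha> k" for k
    proof (induction k)
      case (Suc k)
      have "e * (e ^ k * \<alpha> 0) \<le> e * \<alpha> k" using Suc e by simp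
      then show ?case using grow[of k] by (simp add: mult.assoc)
    qed simp
    have argmin: "\<exists>k\<le>n. k \<le> j * M \<and> (\<forall>i\<le>n. \<alpha> k / s j ^ k \<le> \<alpha> i / s j ^ i)" for j
    proof (induction j)
      case 0
      have "s 0 = e" using e by (simp add: s_def)
      then show ?case using geo e by (intro exI[of _ 0]) (auto simp: field_simps)
    next
      case (Suc j)
      then obtain k where k: "k \<le> n" "k \<le> j * M" "\<And>i. i \<le> n \<Longrightarrow> \<alpha> k / s j ^ k \<le> \<alpha> i / s j ^ i"
        by blast
      let ?t = "s (Suc j)"
      obtain l where l: "l \<le> n" "\<And>i. i \<le> n \<Longrightarrow> \<alpha> l / ?t ^ l \<le> \<alpha> i / ?t ^ i"
        using ex_min_if_finite[of "(\<lambda>i. \<alpha> i / ?t ^ i) ` {..n}"] by (auto simp: not_less)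
      consider "\<alpha> k = 0" | "l \<le> k" | "\<alpha> k > 0" "k < l"
        using nonneg[of k] by linarith
      then show ?case
      proof cases
        case 1
        then show ?thesis using k nonneg s(1)[of "Suc j"] by (intro exI[of _ k]) auto
      next
        case 2
        then show ?thesis using k l by (intro exI[of _ l]) auto
      next
        case 3
        define d where "d = l - k"
        have l_eq: "l = k + d" using 3 by (simp add: d_def)
        have "d \<le> M"
        proof (rule ccontr)
          assume "\<not> d \<le> M"
          have low: "(\<alpha> k)\<^sup>2 / 2 \<le> (\<alpha> (k + t) / ?t ^ t)\<^sup>2" if "t < M" for t
          proof -
            \<comment> \<open>minimality at the smaller radius bounds the intermediate terms from below\<close>
            have "\<alpha> k / s j ^ k \<le> \<alpha> (k + t) / s j ^ (k + t)"
              using that \<open>\<not> d \<le> M\<close> l l_eq by (intro k(3)) auto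
            then have a: "\<alpha> k * s j ^ t \<le> \<alpha> (k + t)"
              using s(1)[of j] by (simp add: power_add field_simps)
            have "\<alpha> k * ?t ^ t \<le> \<alpha> k * (q * s j) ^ t"
              using s[of j] s(1)[of "Suc j"] nonneg by (intro mult_left_mono power_mono) auto
            also have "\<dots> = q ^ t * (\<alpha> k * s j ^ t)" by (simp add: power_mult_distrib)
            also have "\<dots> \<le> q ^ t * \<alpha> (k + t)" using a q1 by (intro mult_left_mono) auto
            finally have "\<alpha> k \<le> q ^ t * (\<alpha> (k + t) / ?t ^ t)"
              using s(1)[of "Suc j"] by (simp add: field_simps)
            then have "(\<alpha> k)\<^sup>2 \<le> (q ^ t * (\<alpha> (k + t) / ?t ^ t))\<^sup>2"
              using nonneg by (intro power_mono) auto
            also have "\<dots> = q ^ (2 * t) * (\<alpha> (k + t) / ?t ^ t)\<^sup>2"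
              by (simp add: power_mult_distrib power_divide power_mult[symmetric] mult.commute)
            also have "\<dots> \<le> q ^ (2 * M) * (\<alpha> (k + t) / ?t ^ t)\<^sup>2"
              using that q1 by (intro mult_right_mono power_increasing) auto
            finally show ?thesis by (simp add: qM)
          qed
          have "real M * ((\<alpha> k)\<^sup>2 / 2) = (\<Sum>t<M. (\<alpha> k)\<^sup>2 / 2)" by simp
          also have "\<dots> \<le> (\<Sum>t<M. (\<alpha> (k + t) / ?t ^ t)\<^sup>2)"
            using low by (intro sum_mono) auto
          also have "\<dots> \<le> (\<Sum>t<d. (\<alpha> (k + t) / ?t ^ t)\<^sup>2)"
            using \<open>\<not> d \<le> M\<close> by (intro sum_mono2) auto
          also have "\<dots> \<le> C * (\<alpha> (k + d) / ?t ^ d + \<alpha> k)\<^sup>2" using s[of "Suc j"] by (intro sq)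
          also have "\<dots> \<le> C * (2 * \<alpha> k)\<^sup>2"
          proof -
            have "\<alpha> (k + d) / ?t ^ d \<le> \<alpha> k"
              using l(2)[OF k(1)] s(1)[of "Suc j"] by (simp add: l_eq power_add field_simps)
            then show ?thesis
              using C nonneg[of k] nonneg[of "k + d"] s(1)[of "Suc j"]
              by (intro mult_left_mono power_mono) auto
          qed
          finally have "(real M - 8 * C) * (\<alpha> k)\<^sup>2 \<le> 0"
            by (simp add: power2_eq_square algebra_simps)
          then show False using M 3 by (auto simp: mult_le_0_iff)
        qed
        then show ?thesis using k l l_eq by (intro exI[of _ l]) auto
      qed
    qed
    obtain k where k: "k \<le> n" "k \<le> J * M" "\<alpha> k \<le> \<alpha> n"
      using argmin[of J] by (auto simp: sJ)
    have "e ^ (J * M) * \<alpha> 0 \<le> e ^ k * \<alpha> 0"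
      using e k nonneg by (intro mult_right_mono power_decreasing) auto
    then show ?thesis using geo[of k] k by linarith
  qed
  show ?thesis
    using main e by (intro exI[of _ "e ^ (J * M)"]) auto
qed

text \<open>
  On a disc where all translates of an operator are uniformly bounded below, the lower bounds of the
  powers grow at least like the powers of the radius of the disc. For operators
  on Banach spaces this is the nontrivial half of a theorem of Makai and Zemanek; the proof given here
  is elementary and relies on the Hilbert norm through Parseval's identity.
\<close>

lemma bounded_below_powers:
  fixes A :: "'a :: complex_inner \<Rightarrow>\<^sub>L 'a"
  assumes A: "A \<in> clinear_ops" and inv: "A ` N \<subseteq> N" and N: "closed_csubspace N"
    and c: "c > 0" and r: "r > 0"
    and below: "\<And>x z. x \<in> N \<Longrightarrow> cmod z \<le> r \<Longrightarrow> c * norm x \<le> norm (A x - z *\<^sub>C x)"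
  shows "\<exists>\<kappa>>0. \<forall>x\<in>N. \<forall>n. \<kappa> * r ^ n * norm x \<le> norm (op_power A n x)"
proof -
  define e where "e = min 1 (c / r)"
  have e: "0 < e" "e \<le> 1" using c r by (auto simp: e_def)
  have C0: "r\<^sup>2 / c\<^sup>2 \<ge> 0" by simp
  obtain \<kappa> where k: "\<kappa> > 0"
    and dec: "\<And>\<alpha> n. resists_flatness e (r\<^sup>2 / c\<^sup>2) \<alpha> \<Longrightarrow> \<kappa> * \<alpha> 0 \<le> \<alpha> n"
    using no_initial_decay[OF C0 e] by blast
  have add: "op_power A (m + k) x = op_power A k (op_power A m x)" for m k and x :: 'a
    by (induction k) simp_all
  have "\<kappa> * r ^ n * norm x \<le> norm (op_power A n x)" if x: "x \<in> N" for x n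
  proof -
    define \<alpha> where "\<alpha> k = norm (op_power A k x) / r ^ k" for k
    have "resists_flatness e (r\<^sup>2 / c\<^sup>2) \<alpha>"
      unfolding resists_flatness_def
    proof (intro conjI allI impI)
      show "0 \<le> \<alpha> k" for k using r by (simp add: \<alpha>_def)
      show "e * \<alpha> k \<le> \<alpha> (Suc k)" for k
      proof -
        have "e * norm (op_power A k x) \<le> c / r * norm (op_power A k x)"
          by (intro mult_right_mono) (simp_all add: e_def)
        also have "\<dots> \<le> norm (A (op_power A k x)) / r"
          using below[OF op_power_mono[OF inv x], of 0] r by (simp add: divide_right_mono)
        finally show ?thesis using r by (simp add: \<alpha>_def field_simps)
      qed
      show "(\<Sum>k<n. (\<alpha> (m + k) / \<sigma> ^ k)\<^sup>2) \<le> r\<^sup>2 / c\<^sup>2 * (\<alpha> (m + n) / \<sigma> ^ n + \<alpha> m)\<^sup>2"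
        if sg: "0 < \<sigma>" "\<sigma> \<le> 1" for \<sigma> m n
      proof -
        let ?y = "op_power A m x" and ?\<rho> = "\<sigma> * r"
        have rho: "0 < ?\<rho>" "?\<rho> \<le> r" using sg r by auto
        have al: "\<alpha> (m + k) / \<sigma> ^ k = (norm (op_power A k ?y) / ?\<rho> ^ k) / r ^ m" for k
          by (simp add: \<alpha>_def add power_add power_mult_distrib mult_ac)
        have "c\<^sup>2 * (\<Sum>k<n. (norm (op_power A k ?y) / ?\<rho> ^ k)\<^sup>2)
            \<le> ?\<rho>\<^sup>2 * (norm (op_power A n ?y) / ?\<rho> ^ n + norm ?y)\<^sup>2"
          by (rule orbit_square_sum_bound[OF A inv N c _ op_power_mono[OF inv x] rho(1)])
            (use below rho in auto)
        also have "\<dots> \<le> r\<^sup>2 * (norm (op_power A n ?y) / ?\<rho> ^ n + norm ?y)\<^sup>2"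
          using rho by (intro mult_right_mono power_mono) auto
        finally have "(\<Sum>k<n. (norm (op_power A k ?y) / ?\<rho> ^ k)\<^sup>2)
            \<le> r\<^sup>2 / c\<^sup>2 * (norm (op_power A n ?y) / ?\<rho> ^ n + norm ?y)\<^sup>2"
          using c by (simp add: field_simps)
        then have "(\<Sum>k<n. (norm (op_power A k ?y) / ?\<rho> ^ k)\<^sup>2) / (r ^ m)\<^sup>2
            \<le> r\<^sup>2 / c\<^sup>2 * (norm (op_power A n ?y) / ?\<rho> ^ n + norm ?y)\<^sup>2 / (r ^ m)\<^sup>2"
          by (rule divide_right_mono) simp
        also have "\<dots> = r\<^sup>2 / c\<^sup>2 * (\<alpha> (m + n) / \<sigma> ^ n + \<alpha> m)\<^sup>2"
        proof -
          have "\<alpha> (m + n) / \<sigma> ^ n + \<alpha> m = (norm (op_power A n ?y) / ?\<rho> ^ n + norm ?y) / r ^ m"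
            unfolding al by (simp add: \<alpha>_def add_divide_distrib)
          then show ?thesis by (simp only: power_divide times_divide_eq_right)
        qed
        also have "(\<Sum>k<n. (norm (op_power A k ?y) / ?\<rho> ^ k)\<^sup>2) / (r ^ m)\<^sup>2
            = (\<Sum>k<n. (\<alpha> (m + k) / \<sigma> ^ k)\<^sup>2)"
          unfolding al by (simp add: power_divide sum_divide_distrib power_mult_distrib)
        finally show ?thesis .
      qed
    qed
    from dec[OF this, of n] show ?thesis using r by (simp add: \<alpha>_def field_simps)
  qed
  then show ?thesis using k by blast
qed

text \<open>
  In the equivalent inner product \<open>G u v = (\<Sum>k<K. s^(-2k) <A^k u, A^k v>)\<close> the operator \<open>A\<close> expands
  norms by the factor \<open>s\<close>: passing from \<open>u\<close> to \<open>A u\<close> shifts the sum by one term, and the hypothesis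
  says that the term gained exceeds the term lost. Let \<open>L y\<close> be the preimage under \<open>A\<close> of the
  \<open>G\<close>-orthogonal projection of \<open>y\<close> to \<open>A N\<close>. It contracts the \<open>G\<close>-norm by \<open>s\<close>, so its powers decay
  geometrically in the \<open>G\<close>-norm and, up to a constant, in the original norm.
\<close>

lemma left_inverse_with_geometric_growth:
  fixes A :: "'a :: complex_hilbert_space \<Rightarrow>\<^sub>L 'a"
  assumes A: "A \<in> clinear_ops" and inv: "A ` N \<subseteq> N" and N: "closed_csubspace N"
    and s: "s > 0" and K: "K > 0"
    and pow: "\<And>x. x \<in> N \<Longrightarrow> s ^ K * norm x \<le> norm (op_power A K x)"
  shows "\<exists>(L :: 'a \<Rightarrow>\<^sub>L 'a) C. L \<in> clinear_ops \<and> (\<forall>x. L x \<in> N) \<and> (\<forall>x\<in>N. L (A x) = x) \<and>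
     (\<forall>n x. norm (op_power L n x) \<le> C * inverse s ^ n * norm x)"
proof -
  note Ns = closed_csubspaceD[OF N]
  define G where "G u v = (\<Sum>k<K. complex_of_real (inverse (s ^ (2 * k))) * cinner (op_power A k u) (op_power A k v))"
    for u v :: 'a
  have opA: "op_power A k (c *\<^sub>C u) = c *\<^sub>C op_power A k u" for k c and u :: 'a
    using clinear_opsD[OF op_power_clinear[OF A]] .
  have Gc: "G (c *\<^sub>C u) v = c * G u v" "G u (c *\<^sub>C v) = cnj c * G u v" for c u v
    by (simp_all add: G_def opA cinner_scaleC_left cinner_scaleC_right sum_distrib_left mult_ac)
  have Gherm: "G u v = cnj (G v u)" for u v
    unfolding G_def cnj_sum by (intro sum.cong refl) (simp add: cinner_commute[symmetric])
  \<comment> \<open>the constant of the equivalence of the two norms\<close>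
  define C1 where "C1 = (\<Sum>k<K. inverse (s ^ (2 * k)) * (norm (op_power A k))\<^sup>2)"
  have C1: "cmod (G u v) \<le> norm u * norm v * C1" for u v
  proof -
    have "cmod (G u v) \<le> (\<Sum>k<K. inverse (s ^ (2 * k)) * (norm (op_power A k))\<^sup>2 * (norm u * norm v))"
      unfolding G_def
    proof (rule sum_norm_le)
      fix k
      have "cmod (cinner (op_power A k u) (op_power A k v)) \<le> norm (op_power A k u) * norm (op_power A k v)"
        by (rule Cauchy_Schwarz_cinner)
      also have "\<dots> \<le> (norm (op_power A k) * norm u) * (norm (op_power A k) * norm v)"
        by (intro mult_mono norm_blinfun) auto
      finally have "inverse (s ^ (2 * k)) * cmod (cinner (op_power A k u) (op_power A k v))
         \<le> inverse (s ^ (2 * k)) * ((norm (op_power A k) * norm u) * (norm (op_power A k) * norm v))"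
        using s by (intro mult_left_mono) auto
      then show "cmod (complex_of_real (inverse (s ^ (2 * k))) * cinner (op_power A k u) (op_power A k v))
         \<le> inverse (s ^ (2 * k)) * (norm (op_power A k))\<^sup>2 * (norm u * norm v)"
        using s by (simp only: norm_mult norm_of_real) (simp add: power2_eq_square mult_ac)
    qed
    then show ?thesis by (simp add: C1_def sum_distrib_left sum_distrib_right mult_ac)
  qed
  have Gb: "bounded_bilinear G"
  proof (rule bounded_bilinear.intro)
    show "G (a + a') b = G a b + G a' b" for a a' b
      by (simp add: G_def bl_simps cinner_add_left algebra_simps sum.distrib)
    show "G a (b + b') = G a b + G a b'" for a b b'
      by (simp add: G_def bl_simps cinner_add_right algebra_simps sum.distrib)
  qed (use C1 in \<open>auto simp: scaleR_scaleC Gc scaleR_conv_of_real\<close>)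
  interpret G: bounded_bilinear G by (rule Gb)
  define g where "g u = Re (G u u)" for u
  have Gg: "G u u = of_real (g u)" for u
    using Gherm[of u u] by (simp add: g_def complex_eq_iff)
  have g_eq: "g u = (\<Sum>k<K. inverse (s ^ (2 * k)) * (norm (op_power A k u))\<^sup>2)" for u
    unfolding g_def G_def cinner_norm by (simp only: of_real_mult[symmetric] Re_sum Re_complex_of_real)
  have glow: "(norm u)\<^sup>2 \<le> g u" for u
  proof -
    have "(\<Sum>k\<in>{0}. inverse (s ^ (2 * k)) * (norm (op_power A k u))\<^sup>2) \<le> g u"
      unfolding g_eq using K s by (intro sum_mono2) auto
    then show ?thesis by simp
  qed
  have gup: "g u \<le> C1 * (norm u)\<^sup>2" for u
    using C1[of u u] complex_Re_le_cmod[of "G u u"] by (simp add: g_def power2_eq_square mult_ac)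
  have gA: "s\<^sup>2 * g u \<le> g (A u)" if "u \<in> N" for u
  proof -
    define a where "a k = inverse (s ^ (2 * k)) * (norm (op_power A k u))\<^sup>2" for k
    have eq: "g (A u) = s\<^sup>2 * (\<Sum>k<K. a (Suc k))"
      unfolding g_eq sum_distrib_left a_def
      using s by (intro sum.cong refl) (simp add: op_power_Suc_apply power2_eq_square field_simps)
    have tele: "(\<Sum>k<K. a (Suc k)) = (\<Sum>k<K. a k) + (a K - a 0)"
      using sum_lessThan_telescope[of a K] by (simp add: sum_subtractf)
    have "a 0 \<le> a K"
    proof -
      have "(s ^ K * norm u)\<^sup>2 \<le> (norm (op_power A K u))\<^sup>2"
        using pow[OF that] s by (intro power_mono) auto
      then show ?thesis using s by (simp add: a_def field_simps power_mult_distrib power_even_eq power_mult[symmetric] mult.commute)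
    qed
    then have "s\<^sup>2 * (\<Sum>k<K. a k) \<le> s\<^sup>2 * (\<Sum>k<K. a (Suc k))"
      unfolding tele by (intro mult_left_mono) auto
    then show ?thesis unfolding eq by (simp add: g_eq a_def)
  qed
  have s2: "s\<^sup>2 > 0" using s by simp
  have GbA: "bounded_bilinear (\<lambda>u v. G (A u) (A v))"
    by (intro G.comp blinfun.bounded_linear_right)
  have ex: "\<exists>u\<in>N. \<forall>v\<in>N. G (A v) y = G (A v) (A u)" for y
  proof (rule form_representation[where c = "s\<^sup>2" and B = "\<lambda>u v. G (A u) (A v)" and f = "\<lambda>v. G (A v) y"])
    show "s\<^sup>2 * (norm u)\<^sup>2 \<le> Re (G (A u) (A u))" if "u \<in> N" for u
      using gA[OF that] mult_left_mono[OF glow[of u], of "s\<^sup>2"] by (simp add: g_def)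
    show "bounded_linear (\<lambda>v. G (A v) y)"
      by (rule bounded_linear_compose[OF G.bounded_linear_left blinfun.bounded_linear_right])
    show "G (A u) (A v) = cnj (G (A v) (A u))" for u v by (rule Gherm)
  qed (use A s in \<open>simp_all add: GbA Gc N s2 clinear_opsD\<close>)
  have "\<forall>y. \<exists>u. u \<in> N \<and> (\<forall>v\<in>N. G (A v) y = G (A v) (A u))"
    using ex by (simp add: Bex_def)
  then obtain l where "\<forall>y. l y \<in> N \<and> (\<forall>v\<in>N. G (A v) y = G (A v) (A (l y)))"
    by (rule choice[THEN exE])
  then have l: "l y \<in> N" "v \<in> N \<Longrightarrow> G (A v) (A (l y)) = G (A v) y" for y v
    by (blast, metis)
  have uniq: "l y = u" if u: "u \<in> N" "\<And>v. v \<in> N \<Longrightarrow> G (A v) y = G (A v) (A u)" for y u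
  proof -
    let ?d = "l y - u"
    have d: "?d \<in> N" using l u Ns by auto
    have "G (A ?d) (A ?d) = 0"
      using l(2)[OF d] u(2)[OF d] by (simp add: bl_simps G.diff_right)
    then have "g (A ?d) = 0" using Gg[of "A ?d"] by simp
    then have "s\<^sup>2 * (norm ?d)\<^sup>2 \<le> 0" using gA[OF d] mult_left_mono[OF glow[of ?d], of "s\<^sup>2"] by simp
    then show ?thesis using s2 by (simp add: mult_le_0_iff)
  qed
  have add: "l (x + y) = l x + l y" for x y
    by (rule uniq) (use l Ns in \<open>auto simp: G.add_right bl_simps\<close>)
  have sc: "l (c *\<^sub>C x) = c *\<^sub>C l x" for c x
    by (rule uniq) (use l Ns A in \<open>auto simp: Gc clinear_opsD\<close>)
  have lA: "l (A x) = x" if "x \<in> N" for x by (rule uniq) (use that in auto)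
  have gl: "s\<^sup>2 * g (l y) \<le> g y" for y
  proof -
    let ?w = "A (l y)"
    \<comment> \<open>Pythagoras: \<open>?w\<close> is the \<open>G\<close>-orthogonal projection of \<open>y\<close>\<close>
    have wy: "G ?w y = of_real (g ?w)" using l(2)[OF l(1), of y y] by (simp add: Gg)
    have yw: "G y ?w = of_real (g ?w)" by (subst Gherm) (simp add: wy)
    have "0 \<le> g (y - ?w)" using glow[of "y - ?w"] by (smt (verit) zero_le_power2)
    also have "g (y - ?w) = g y - g ?w"
      by (simp add: g_def G.diff_left G.diff_right wy yw)
    finally show ?thesis using gA[OF l(1)[of y]] by simp
  qed
  have C1nn: "C1 \<ge> 0" unfolding C1_def using s by (intro sum_nonneg) auto
  have bd: "norm (l x) \<le> norm x * (sqrt C1 / s)" for x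
  proof -
    have "s\<^sup>2 * (norm (l x))\<^sup>2 \<le> C1 * (norm x)\<^sup>2"
      using mult_left_mono[OF glow[of "l x"], of "s\<^sup>2"] gl[of x] gup[of x] by simp
    then have "(s * norm (l x))\<^sup>2 \<le> (sqrt C1 * norm x)\<^sup>2"
      using C1nn by (simp add: power_mult_distrib)
    then have "s * norm (l x) \<le> sqrt C1 * norm x"
      by (rule power2_le_imp_le) (use C1nn in simp)
    then show ?thesis using s by (simp add: field_simps)
  qed
  obtain L where L: "L \<in> clinear_ops" "blinfun_apply L = l"
    using clinear_op_exists[of l, OF add sc bd] by blast
  have it: "s ^ (2 * n) * g (op_power L n x) \<le> g x" for n x
  proof (induction n)
    case (Suc n)
    have "s ^ (2 * Suc n) * g (op_power L (Suc n) x) = s ^ (2 * n) * (s\<^sup>2 * g (l (op_power L n x)))"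
      by (simp add: L power2_eq_square)
    also have "\<dots> \<le> s ^ (2 * n) * g (op_power L n x)"
      using gl s by (intro mult_left_mono) auto
    finally show ?case using Suc by simp
  qed simp
  have "norm (op_power L n x) \<le> sqrt C1 * inverse s ^ n * norm x" for n x
  proof -
    have "s ^ (2 * n) * (norm (op_power L n x))\<^sup>2 \<le> C1 * (norm x)\<^sup>2"
    proof -
      have "s ^ (2 * n) * (norm (op_power L n x))\<^sup>2 \<le> s ^ (2 * n) * g (op_power L n x)"
        using glow s by (intro mult_left_mono) auto
      then show ?thesis using it[of n x] gup[of x] by linarith
    qed
    then have "(s ^ n * norm (op_power L n x))\<^sup>2 \<le> (sqrt C1 * norm x)\<^sup>2"
      using C1nn by (simp add: power_mult_distrib power_even_eq)
    then have "s ^ n * norm (op_power L n x) \<le> sqrt C1 * norm x"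
      by (rule power2_le_imp_le) (use C1nn in simp)
    then show ?thesis using s by (simp add: field_simps power_inverse)
  qed
  then show ?thesis using L l lA by (intro exI[of _ L] exI[of _ "sqrt C1"]) auto
qed

section \<open>Operator-valued holomorphic functions\<close>

lemma vector_holomorphic_on_const: "vector_holomorphic_on (\<lambda>z. A) U"
  unfolding vector_holomorphic_on_def by (intro ballI exI[of _ 0]) simp

lemma vector_holomorphic_on_linear:
  fixes A B :: "'a :: complex_normed_vector \<Rightarrow>\<^sub>L 'a"
  shows "vector_holomorphic_on (\<lambda>z. z *\<^sub>C A - B) U"
  unfolding vector_holomorphic_on_def
proof (intro ballI exI[of _ A])
  have "bounded_linear (\<lambda>z. z *\<^sub>C A)"
    by (rule bounded_linear_intro[where K = "norm A"])
      (simp_all add: scaleC_alg scaleR_scaleC scaleR_conv_of_real norm_scaleC)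
  then show "((\<lambda>z. z *\<^sub>C A - B) has_derivative (\<lambda>h. h *\<^sub>C A)) (at z within U)" for z
    using has_derivative_diff[OF bounded_linear_imp_has_derivative has_derivative_const] by fastforce
qed

lemma vector_holomorphic_on_compose:
  fixes F G :: "complex \<Rightarrow> 'a :: complex_normed_vector \<Rightarrow>\<^sub>L 'a"
  assumes F: "vector_holomorphic_on F U" "F ` U \<subseteq> clinear_ops" and G: "vector_holomorphic_on G U"
  shows "vector_holomorphic_on (\<lambda>z. F z o\<^sub>L G z) U"
  unfolding vector_holomorphic_on_def
proof
  fix z assume z: "z \<in> U"
  obtain D E where D: "(F has_derivative (\<lambda>h. h *\<^sub>C D)) (at z within U)"
    and E: "(G has_derivative (\<lambda>h. h *\<^sub>C E)) (at z within U)"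
    using F G z unfolding vector_holomorphic_on_def by metis
  have "(\<lambda>h. (F z o\<^sub>L h *\<^sub>C E) + (h *\<^sub>C D o\<^sub>L G z)) = (\<lambda>h. h *\<^sub>C ((F z o\<^sub>L E) + (D o\<^sub>L G z)))"
    using F(2) z by (auto simp: fun_eq_iff blinfun_eq_iff bl_simps scaleC_alg clinear_opsD image_subset_iff)
  then show "\<exists>D. ((\<lambda>z. F z o\<^sub>L G z) has_derivative (\<lambda>h. h *\<^sub>C D)) (at z within U)"
    using bounded_bilinear.FDERIV[OF bounded_bilinear_blinfun_compose D E] by metis
qed

text \<open>
  The resolvent identity \<open>R z - R w = (z - w) (R z B R w)\<close> first bounds \<open>R\<close> near \<open>w\<close>, and then exhibits
  \<open>R w B R w\<close> as the derivative. Pencils are used because both \<open>z - E\<close> and \<open>1 - z S\<close> occur below.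
\<close>

lemma vector_holomorphic_on_inverse_pencil:
  fixes A B :: "'a :: complex_normed_vector \<Rightarrow>\<^sub>L 'a"
  assumes lin: "\<And>z. z \<in> U \<Longrightarrow> R z \<in> clinear_ops"
    and B: "B \<in> clinear_ops"
    and right: "\<And>z. z \<in> U \<Longrightarrow> (A - z *\<^sub>C B) o\<^sub>L R z = id_blinfun"
    and left: "\<And>z. z \<in> U \<Longrightarrow> R z o\<^sub>L (A - z *\<^sub>C B) = id_blinfun"
  shows "vector_holomorphic_on R U"
  unfolding vector_holomorphic_on_def
proof
  fix w assume w: "w \<in> U"
  define X where "X = B o\<^sub>L R w"
  define b where "b = norm X"
  have res: "R z - R w = (z - w) *\<^sub>C (R z o\<^sub>L X)" if z: "z \<in> U" for z
  proof -
    have "R z x - R w x = (z - w) *\<^sub>C R z (X x)" for x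
    proof -
      have "A (R w x) - w *\<^sub>C B (R w x) = x"
        using right[OF w] by (simp add: blinfun_eq_iff bl_simps)
      then have "R z x = R z ((A - z *\<^sub>C B) (R w x) + (z - w) *\<^sub>C X x)"
        by (simp add: X_def bl_simps scaleC_alg)
      also have "\<dots> = R w x + (z - w) *\<^sub>C R z (X x)"
        using left[OF z] lin[OF z]
        by (simp add: blinfun.add_right clinear_opsD) (simp add: blinfun_eq_iff)
      finally show ?thesis by simp
    qed
    then show ?thesis by (simp add: blinfun_eq_iff bl_simps)
  qed
  define K where "K = 2 * norm (R w)"
  have bound: "norm (R z) \<le> K" if z: "z \<in> U" "dist z w < 1 / (2 * (b + 1))" for z
  proof -
    have b0: "b \<ge> 0" by (simp add: b_def)
    have "norm (R z) \<le> norm (R w) + norm (R z - R w)"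
      by (metis add_diff_cancel_left' diff_add_cancel norm_triangle_ineq)
    also have "norm (R z - R w) \<le> cmod (z - w) * (norm (R z) * b)"
      unfolding res[OF z(1)] norm_scaleC b_def by (intro mult_left_mono norm_blinfun_compose) simp
    also have "\<dots> = norm (R z) * (cmod (z - w) * b)" by simp
    also have "\<dots> \<le> norm (R z) * (1 / 2)"
    proof (rule mult_left_mono)
      have "cmod (z - w) * b \<le> 1 / (2 * (b + 1)) * b"
        using z b0 by (intro mult_right_mono) (auto simp: dist_norm)
      also have "\<dots> \<le> 1 / 2" using b0 by (simp add: field_simps)
      finally show "cmod (z - w) * b \<le> 1 / 2" .
    qed simp
    finally show ?thesis by (simp add: K_def)
  qed
  have "(R has_derivative (\<lambda>h. h *\<^sub>C (R w o\<^sub>L X))) (at w within U)"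
  proof (rule has_derivativeI_sandwich[where e = "1 / (2 * (b + 1))" and H = "\<lambda>z. cmod (z - w) * (K * b * b)"])
    have "b \<ge> 0" by (simp add: b_def)
    then show "0 < 1 / (2 * (b + 1))" by simp
    show "bounded_linear (\<lambda>h. h *\<^sub>C (R w o\<^sub>L X))"
      by (rule bounded_linear_intro[where K = "norm (R w o\<^sub>L X)"])
        (simp_all add: scaleC_alg scaleR_scaleC scaleR_conv_of_real norm_scaleC)
    have "((\<lambda>z. cmod (z - w) * (K * b * b)) \<longlongrightarrow> cmod (w - w) * (K * b * b)) (at w within U)"
      by (intro tendsto_intros)
    then show "((\<lambda>z. cmod (z - w) * (K * b * b)) \<longlongrightarrow> 0) (at w within U)" by simp
    fix z assume z: "z \<in> U" "z \<noteq> w" "dist z w < 1 / (2 * (b + 1))"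
    have "R z - R w - (z - w) *\<^sub>C (R w o\<^sub>L X) = (z - w) *\<^sub>C ((R z - R w) o\<^sub>L X)"
      by (subst res[OF z(1)]) (simp add: blinfun_eq_iff bl_simps scaleC_alg)
    also have "\<dots> = (z - w) *\<^sub>C ((z - w) *\<^sub>C (R z o\<^sub>L X) o\<^sub>L X)"
      by (subst res[OF z(1)]) simp
    also have "norm \<dots> \<le> cmod (z - w) * (cmod (z - w) * (K * b) * b)"
      unfolding norm_scaleC
    proof (intro mult_left_mono order_trans[OF norm_blinfun_compose])
      have "norm (R z o\<^sub>L X) \<le> K * b"
        unfolding b_def
        by (intro order_trans[OF norm_blinfun_compose] mult_right_mono bound z) auto
      then show "norm ((z - w) *\<^sub>C (R z o\<^sub>L X)) * norm X \<le> cmod (z - w) * (K * b) * b"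
        by (auto simp: norm_scaleC b_def intro!: mult_right_mono mult_left_mono)
    qed simp
    finally show "norm (R z - R w - (z - w) *\<^sub>C (R w o\<^sub>L X)) / norm (z - w) \<le> cmod (z - w) * (K * b * b)"
      using z(2) by (simp add: field_simps)
  qed
  then show "\<exists>D. (R has_derivative (\<lambda>h. h *\<^sub>C D)) (at w within U)" by blast
qed

lemma vector_holomorphic_on_imp_holomorphic_cinner:
  fixes F :: "complex \<Rightarrow> 'a :: complex_inner \<Rightarrow>\<^sub>L 'a"
  assumes "vector_holomorphic_on F U"
  shows "(\<lambda>z. cinner (F z x) y) holomorphic_on U"
  unfolding holomorphic_on_def
proof
  fix z assume "z \<in> U"
  then obtain D where D: "(F has_derivative (\<lambda>h. h *\<^sub>C D)) (at z within U)"
    using assms by (auto simp: vector_holomorphic_on_def)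
  have "bounded_linear (\<lambda>A :: 'a \<Rightarrow>\<^sub>L 'a. cinner (A x) y)"
    by (intro bounded_linear_compose[OF bounded_linear_cinner_left] blinfun.bounded_linear_left)
  from bounded_linear.has_derivative[OF this D]
  have "((\<lambda>z. cinner (F z x) y) has_derivative (\<lambda>h. h * cinner (D x) y)) (at z within U)"
    by (simp add: bl_simps cinner_scaleC_left)
  then have "((\<lambda>z. cinner (F z x) y) has_field_derivative cinner (D x) y) (at z within U)"
    by (simp add: has_field_derivative_def mult_commute_abs)
  then show "(\<lambda>z. cinner (F z x) y) field_differentiable at z within U"
    by (auto simp: field_differentiable_def)
qed

text \<open>
  Otherwise the matrix coefficients of the resolvent would be entire functions that vanish at
  infinity, hence zero.
\<close>

lemma op_spectrum_nonempty:
  fixes E :: "'a :: complex_inner \<Rightarrow>\<^sub>L 'a" and x :: 'a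
  assumes E: "E \<in> clinear_ops" and x: "x \<noteq> 0"
  shows "op_spectrum E \<noteq> {}"
proof
  assume "op_spectrum E = {}"
  then have "\<forall>z. \<exists>B\<in>clinear_ops. (z *\<^sub>C id_blinfun - E) o\<^sub>L B = id_blinfun
      \<and> B o\<^sub>L (z *\<^sub>C id_blinfun - E) = id_blinfun"
    by (auto simp: op_spectrum_def)
  then obtain R where R: "R z \<in> clinear_ops" "(z *\<^sub>C id_blinfun - E) o\<^sub>L R z = id_blinfun"
      "R z o\<^sub>L (z *\<^sub>C id_blinfun - E) = id_blinfun" for z
    by metis
  have eq: "z *\<^sub>C id_blinfun - E = - E - z *\<^sub>C (- id_blinfun)" for z
    by (simp add: scaleC_alg)
  have hol: "vector_holomorphic_on R UNIV"
    by (rule vector_holomorphic_on_inverse_pencil[where A = "- E" and B = "- id_blinfun"])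
      (use R in \<open>auto simp: eq[symmetric] intro!: clinear_ops_intros\<close>)
  have "cinner (R 0 x) y = 0" for y
  proof (rule Liouville_weak_0[of "\<lambda>z. cinner (R z x) y"])
    show "(\<lambda>z. cinner (R z x) y) holomorphic_on UNIV"
      by (rule vector_holomorphic_on_imp_holomorphic_cinner[OF hol])
    have bound: "cmod (cinner (R z x) y) \<le> norm x * norm y / d" if "d > 0" "norm E + d \<le> cmod z" for z d
    proof -
      have "z *\<^sub>C R z x = x + E (R z x)"
        using R(2)[of z] by (simp add: blinfun_eq_iff bl_simps algebra_simps)
      then have "cmod z * norm (R z x) \<le> norm x + norm (E (R z x))"
        by (metis norm_scaleC norm_triangle_ineq)
      also have "\<dots> \<le> norm x + norm E * norm (R z x)" using norm_blinfun by simp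
      finally have "(cmod z - norm E) * norm (R z x) \<le> norm x" by (simp add: algebra_simps)
      moreover have "d * norm (R z x) \<le> (cmod z - norm E) * norm (R z x)"
        using that by (intro mult_right_mono) auto
      ultimately have "norm (R z x) \<le> norm x / d" using that by (simp add: field_simps)
      then have "norm (R z x) * norm y \<le> norm x / d * norm y" by (rule mult_right_mono) simp
      then show ?thesis using Cauchy_Schwarz_cinner[of "R z x" y] by simp
    qed
    show "((\<lambda>z. cinner (R z x) y) \<longlongrightarrow> 0) at_infinity"
      unfolding Lim_at_infinity dist_norm
    proof (intro allI impI)
      fix e :: real assume e: "e > 0"
      define d where "d = (norm x * norm y + 1) / e"
      have d: "d > 0" using e by (auto simp: d_def intro!: divide_pos_pos add_nonneg_pos)
      have "norm x * norm y / d < e"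
        using e d by (simp add: d_def field_simps add_nonneg_pos)
      then have "norm (cinner (R z x) y - 0) < e" if "norm E + d \<le> cmod z" for z
        using bound[OF d that] by simp
      then show "\<exists>b. \<forall>z. b \<le> cmod z \<longrightarrow> norm (cinner (R z x) y - 0) < e" by blast
    qed
  qed
  then have "R 0 x = 0"
    by (metis cinner_norm norm_eq_zero of_real_eq_0_iff zero_eq_power2)
  then have "x = 0" using R(2)[of 0] by (simp add: blinfun_eq_iff) (metis blinfun.zero_right)
  then show False using x by simp
qed

section \<open>The closed span of the eigenvectors at regular points\<close>

text \<open>
  For the backward shift this is the whole space, for an invertible operator it may be zero. It takes
  the place of the generalized range \<open>\<Inter>n. T^n H\<close>, and has the advantage that it is attached to the whole
  regular set at once, so that nothing has to be propagated along paths in \<open>reg T\<close>.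
\<close>

definition eigen_core :: "('a :: complex_normed_vector \<Rightarrow>\<^sub>L 'a) \<Rightarrow> 'a set" where
  "eigen_core T = \<Inter> {N. closed_csubspace N \<and> (\<forall>\<mu>\<in>reg T. \<forall>x. T x = \<mu> *\<^sub>C x \<longrightarrow> x \<in> N)}"

lemma eigen_core_csubspace: "closed_csubspace (eigen_core T)"
  unfolding closed_csubspace_def eigen_core_def by (auto intro!: closed_Inter)

lemma eigen_core_eigenvector: "\<mu> \<in> reg T \<Longrightarrow> blinfun_apply T x = \<mu> *\<^sub>C x \<Longrightarrow> x \<in> eigen_core T"
  by (auto simp: eigen_core_def)

lemma eigen_core_least:
  "closed_csubspace N \<Longrightarrow> (\<And>\<mu> x. \<mu> \<in> reg T \<Longrightarrow> blinfun_apply T x = \<mu> *\<^sub>C x \<Longrightarrow> x \<in> N)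
    \<Longrightarrow> eigen_core T \<subseteq> N"
  by (auto simp: eigen_core_def)

lemma closed_csubspace_vimage:
  assumes "closed_csubspace N" "A \<in> clinear_ops"
  shows "closed_csubspace (blinfun_apply A -` N)"
  using assms closed_vimage[of N "blinfun_apply A"]
  by (auto simp: closed_csubspace_def bl_simps clinear_opsD intro!: continuous_intros)

lemma closed_csubspace_Int:
  "closed_csubspace M \<Longrightarrow> closed_csubspace N \<Longrightarrow> closed_csubspace (M \<inter> N)"
  by (auto simp: closed_csubspace_def)

lemma closed_csubspace_zero: "closed_csubspace {0}"
  by (auto simp: closed_csubspace_def)

lemma eigen_core_invariant:
  assumes "T \<in> clinear_ops" "x \<in> eigen_core T"
  shows "T x \<in> eigen_core T"
proof -
  have "eigen_core T \<subseteq> blinfun_apply T -` eigen_core T"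
    by (rule eigen_core_least)
      (auto intro!: closed_csubspace_vimage eigen_core_csubspace assms
        closed_csubspaceD(4)[OF eigen_core_csubspace] intro: eigen_core_eigenvector)
  then show ?thesis using assms by auto
qed

lemma reg_iff:
  "z \<in> reg T \<longleftrightarrow> (\<exists>U F. open U \<and> z \<in> U \<and> F ` U \<subseteq> clinear_ops \<and> vector_holomorphic_on F U \<and>
     (\<forall>\<mu>\<in>U. (\<mu> *\<^sub>C id_blinfun - T) o\<^sub>L F \<mu> o\<^sub>L (\<mu> *\<^sub>C id_blinfun - T) = \<mu> *\<^sub>C id_blinfun - T \<and>
             F \<mu> o\<^sub>L (\<mu> *\<^sub>C id_blinfun - T) o\<^sub>L F \<mu> = F \<mu>))"
  by (simp add: reg_def)

lemma reg_local_inverse: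
  fixes T :: "'a :: complex_normed_vector \<Rightarrow>\<^sub>L 'a"
  assumes "\<zeta> \<in> reg T"
  obtains U F where "open U" "\<zeta> \<in> U" "U \<subseteq> reg T" "continuous_on U F"
    "\<forall>\<mu>\<in>U. F \<mu> \<in> clinear_ops"
    "\<forall>\<mu>\<in>U. (\<mu> *\<^sub>C id_blinfun - T) o\<^sub>L F \<mu> o\<^sub>L (\<mu> *\<^sub>C id_blinfun - T) = \<mu> *\<^sub>C id_blinfun - T"
proof -
  obtain U F where UF: "open U" "\<zeta> \<in> U" "F ` U \<subseteq> clinear_ops" "vector_holomorphic_on F U"
     "\<forall>\<mu>\<in>U. (\<mu> *\<^sub>C id_blinfun - T) o\<^sub>L F \<mu> o\<^sub>L (\<mu> *\<^sub>C id_blinfun - T) = \<mu> *\<^sub>C id_blinfun - T \<and>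
             F \<mu> o\<^sub>L (\<mu> *\<^sub>C id_blinfun - T) o\<^sub>L F \<mu> = F \<mu>"
    using assms unfolding reg_iff by (elim exE conjE) (rule that)
  have "U \<subseteq> reg T"
    using UF by (intro subsetI, unfold reg_iff, intro exI[of _ U] exI[of _ F]) simp
  moreover have "continuous_on U F"
    using UF(4) has_derivative_continuous unfolding vector_holomorphic_on_def continuous_on_eq_continuous_within by blast
  ultimately show ?thesis using UF by (intro that[of U F]) auto
qed

text \<open>
  The basic fact about the core \<open>M\<close>: every inner inverse \<open>S\<close> of \<open>\<zeta> - T\<close>, for every regular \<open>\<zeta>\<close>, maps
  \<open>M\<close> into itself and is a right inverse there. In particular \<open>M\<close> lies in the range of \<open>\<zeta> - T\<close>. For an
  eigenvector \<open>y\<close> with eigenvalue \<open>\<mu> \<noteq> \<zeta>\<close> this is algebra: \<open>y\<close> is in the range of \<open>\<zeta> - T\<close>, and \<open>S y\<close>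
  differs from \<open>y / (\<zeta> - \<mu>)\<close> by an element of the kernel of \<open>\<zeta> - T\<close>. An eigenvector with eigenvalue
  \<open>\<zeta>\<close> is a limit of eigenvectors with other eigenvalues, obtained by applying to it the projections
  \<open>1 - F \<mu> (\<mu> - T)\<close> onto the kernels of \<open>\<mu> - T\<close>; here the continuity of \<open>F\<close> enters.
\<close>

lemma eigen_core_generalized_inverse:
  fixes T S :: "'a :: complex_normed_vector \<Rightarrow>\<^sub>L 'a"
  assumes T: "T \<in> clinear_ops" and S: "S \<in> clinear_ops" and reg: "\<zeta> \<in> reg T"
    and ginv: "(\<zeta> *\<^sub>C id_blinfun - T) o\<^sub>L S o\<^sub>L (\<zeta> *\<^sub>C id_blinfun - T) = \<zeta> *\<^sub>C id_blinfun - T"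
    and y: "y \<in> eigen_core T"
  shows "\<zeta> *\<^sub>C S y - T (S y) = y" "S y \<in> eigen_core T"
proof -
  let ?M = "eigen_core T"
  let ?J = "\<zeta> *\<^sub>C id_blinfun - T"
  note M = closed_csubspaceD[OF eigen_core_csubspace[of T]]
  have J: "?J \<in> clinear_ops" using T by (intro clinear_ops_intros)
  have gi: "?J (S (?J x)) = ?J x" for x using ginv by (simp add: blinfun_eq_iff)
  define V where "V = blinfun_apply ((?J o\<^sub>L S) - id_blinfun) -` {0} \<inter> blinfun_apply S -` ?M"
  have V: "closed_csubspace V" unfolding V_def
    by (intro closed_csubspace_Int closed_csubspace_vimage closed_csubspace_zero
        eigen_core_csubspace clinear_ops_intros S T)
  have inV: "y \<in> V \<longleftrightarrow> ?J (S y) = y \<and> S y \<in> ?M" for y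
    by (simp add: V_def bl_simps)
  have other: "y \<in> V" if mu: "\<mu> \<in> reg T" "\<mu> \<noteq> \<zeta>" and eig: "T y = \<mu> *\<^sub>C y" for \<mu> and y :: 'a
  proof -
    have ne: "\<zeta> - \<mu> \<noteq> 0" using mu by simp
    have Jy: "?J y = (\<zeta> - \<mu>) *\<^sub>C y" by (simp add: bl_simps eig scaleC_alg)
    have "(\<zeta> - \<mu>) *\<^sub>C ?J (S y) = ?J (S ((\<zeta> - \<mu>) *\<^sub>C y))"
      by (simp only: clinear_opsD[OF S] clinear_opsD[OF J])
    also have "\<dots> = ?J (S (?J y))" by (simp only: Jy)
    also have "\<dots> = (\<zeta> - \<mu>) *\<^sub>C y" by (simp only: gi) (rule Jy)
    finally have "inverse (\<zeta> - \<mu>) *\<^sub>C (\<zeta> - \<mu>) *\<^sub>C ?J (S y) = inverse (\<zeta> - \<mu>) *\<^sub>C (\<zeta> - \<mu>) *\<^sub>C y" by simp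
    then have JS: "?J (S y) = y" using ne by (simp add: scaleC_scaleC)
    define z where "z = S y - inverse (\<zeta> - \<mu>) *\<^sub>C y"
    have "?J z = 0"
      unfolding z_def blinfun.diff_right clinear_opsD[OF J] JS Jy using ne by (simp add: scaleC_scaleC)
    then have "z \<in> ?M" using eigen_core_eigenvector[OF reg, of z] by (simp add: bl_simps)
    moreover have "y \<in> ?M" using eigen_core_eigenvector mu(1) eig .
    ultimately have "z + inverse (\<zeta> - \<mu>) *\<^sub>C y \<in> ?M" by (intro M)
    then show ?thesis using JS by (simp add: inV z_def)
  qed
  have same: "y \<in> V" if eig: "T y = \<zeta> *\<^sub>C y" for y :: 'a
  proof -
    obtain U F where U: "open U" "\<zeta> \<in> U" "U \<subseteq> reg T" "continuous_on U F"
      and F: "\<forall>\<mu>\<in>U. F \<mu> \<in> clinear_ops"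
        "\<forall>\<mu>\<in>U. (\<mu> *\<^sub>C id_blinfun - T) o\<^sub>L F \<mu> o\<^sub>L (\<mu> *\<^sub>C id_blinfun - T) = \<mu> *\<^sub>C id_blinfun - T"
      by (rule reg_local_inverse[OF reg]) (rule that)
    define f where "f \<mu> = y - (\<mu> - \<zeta>) *\<^sub>C F \<mu> y" for \<mu>
    have "f \<mu> \<in> V" if mu: "\<mu> \<in> U" "\<mu> \<noteq> \<zeta>" for \<mu>
    proof (rule other)
      let ?K = "\<mu> *\<^sub>C id_blinfun - T"
      have K: "?K \<in> clinear_ops" using T by (intro clinear_ops_intros)
      have Ky: "?K y = (\<mu> - \<zeta>) *\<^sub>C y" by (simp add: bl_simps eig scaleC_alg)
      have "f \<mu> = y - F \<mu> (?K y)" by (simp only: f_def Ky clinear_opsD[OF F(1)[rule_format, OF mu(1)]])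
      moreover have "?K (F \<mu> (?K y)) = ?K y" using F(2)[rule_format, OF mu(1)] by (simp add: blinfun_eq_iff)
      ultimately have "?K (f \<mu>) = 0" by (simp only: blinfun.diff_right) simp
      then show "T (f \<mu>) = \<mu> *\<^sub>C f \<mu>" by (simp add: bl_simps)
    qed (use mu U in auto)
    then have ev: "\<forall>\<^sub>F \<mu> in at \<zeta>. f \<mu> \<in> V"
      using U by (auto simp: eventually_at_topological)
    have "isCont F \<zeta>" using U continuous_on_eq_continuous_at by blast
    then have "(F \<longlongrightarrow> F \<zeta>) (at \<zeta>)" by (simp add: isCont_def)
    then have Fy: "((\<lambda>\<mu>. F \<mu> y) \<longlongrightarrow> F \<zeta> y) (at \<zeta>)" by (intro tendsto_intros)
    have "((\<lambda>\<mu>. cmod (\<mu> - \<zeta>) * norm (F \<mu> y)) \<longlongrightarrow> cmod (\<zeta> - \<zeta>) * norm (F \<zeta> y)) (at \<zeta>)"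
      by (intro tendsto_intros Fy)
    then have "((\<lambda>\<mu>. norm (f \<mu> - y)) \<longlongrightarrow> 0) (at \<zeta>)" by (simp add: f_def norm_scaleC)
    then have "(f \<longlongrightarrow> y) (at \<zeta>)" using LIM_zero_iff tendsto_norm_zero_iff by blast
    then show ?thesis
      using Lim_in_closed_set[OF closed_csubspaceD(1)[OF V] ev] by simp
  qed
  have "?M \<subseteq> V" by (rule eigen_core_least[OF V]) (metis other same)
  then have "y \<in> V" using y by blast
  then show "\<zeta> *\<^sub>C S y - T (S y) = y" "S y \<in> ?M" by (auto simp: inV bl_simps)
qed

section \<open>Every inner inverse gives a disc of regular points\<close>

text \<open>
  Near 0 the part of \<open>R z w\<close> orthogonal to \<open>M\<close> satisfies \<open>Q (R z w) = z Q S (Q (R z w))\<close> and so vanishes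
  because \<open>z Q S\<close> is a strict contraction. The identity theorem carries this over to the whole disc.
\<close>

lemma resolvent_preserves_invariant_subspace:
  fixes S :: "'a :: complex_hilbert_space \<Rightarrow>\<^sub>L 'a"
  assumes S: "S \<in> clinear_ops" and SM: "\<And>x. x \<in> M \<Longrightarrow> S x \<in> M" and M: "closed_csubspace M"
    and R: "\<And>z. z \<in> ball 0 t \<Longrightarrow> R z \<in> clinear_ops"
      "\<And>z. z \<in> ball 0 t \<Longrightarrow> (id_blinfun - z *\<^sub>C S) o\<^sub>L R z = id_blinfun"
      "\<And>z. z \<in> ball 0 t \<Longrightarrow> R z o\<^sub>L (id_blinfun - z *\<^sub>C S) = id_blinfun"
    and w: "w \<in> M" and z: "z \<in> ball 0 t"
  shows "R z w \<in> M"
proof -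
  obtain P where P: "P \<in> clinear_ops" "\<And>x. P x \<in> M" "\<And>x. x \<in> M \<Longrightarrow> P x = x"
    "\<And>x y. cinner (P x) y = cinner x (P y)"
    using orthogonal_projection_exists[OF M] by metis
  define Q where "Q = id_blinfun - P"
  have Q0: "Q x = 0 \<longleftrightarrow> x \<in> M" for x
    using P(2)[of x] P(3)[of x] by (auto simp: Q_def bl_simps)
  have QS: "Q (S v) = Q (S (Q v))" for v
  proof -
    have "S (P v) \<in> M" using P SM by blast
    then have "Q (S (P v)) = 0" by (simp add: Q0)
    then show ?thesis by (simp add: Q_def bl_simps)
  qed
  have hol: "vector_holomorphic_on R (ball 0 t)"
    by (rule vector_holomorphic_on_inverse_pencil[OF R(1) S R(2,3)])
  have t: "t > 0" using z by (metis ball_eq_empty empty_iff not_le)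
  define e where "e = min t (1 / (norm Q * norm S + 1))"
  have den: "norm Q * norm S + 1 > 0" by (simp add: add_nonneg_pos)
  have e: "e > 0" using t den by (simp add: e_def)
  have near: "Q (R \<mu> w) = 0" if "\<mu> \<in> ball 0 e" for \<mu>
  proof -
    have mu: "\<mu> \<in> ball 0 t" "cmod \<mu> < 1 / (norm Q * norm S + 1)" using that by (auto simp: e_def)
    have "R \<mu> w = w + \<mu> *\<^sub>C S (R \<mu> w)"
      using R(2)[OF mu(1)] by (simp add: blinfun_eq_iff bl_simps algebra_simps)
    then have "Q (R \<mu> w) = Q w + \<mu> *\<^sub>C Q (S (R \<mu> w))"
      by (metis P(1) Q_def blinfun.add_right clinear_opsD clinear_ops_intros(1) clinear_ops_intros(4))
    also have "Q w = 0" using w by (simp add: Q0)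
    finally have eq: "Q (R \<mu> w) = \<mu> *\<^sub>C Q (S (Q (R \<mu> w)))" using QS[of "R \<mu> w"] by simp
    have "norm (Q (R \<mu> w)) \<le> cmod \<mu> * (norm Q * (norm S * norm (Q (R \<mu> w))))"
      by (subst eq) (simp add: norm_scaleC mult_left_mono order_trans[OF norm_blinfun] norm_blinfun)
    also have "\<dots> = (cmod \<mu> * (norm Q * norm S)) * norm (Q (R \<mu> w))" by simp
    finally have "(1 - cmod \<mu> * (norm Q * norm S)) * norm (Q (R \<mu> w)) \<le> 0"
      by (simp add: algebra_simps)
    moreover have "cmod \<mu> * (norm Q * norm S) < 1"
    proof -
      have "cmod \<mu> * (norm Q * norm S) \<le> cmod \<mu> * (norm Q * norm S + 1)"
        by (intro mult_left_mono) auto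
      also have "\<dots> < 1" using mu(2) den by (simp add: field_simps)
      finally show ?thesis .
    qed
    ultimately show ?thesis by (simp add: mult_le_0_iff)
  qed
  have "cinner (Q (R z w)) y = 0" for y
  proof -
    have Qsym: "cinner (Q x) y = cinner x (Q y)" for x y
      by (simp add: Q_def bl_simps cinner_diff_left cinner_diff_right P(4))
    have "cinner (R z w) (Q y) = 0"
    proof (rule analytic_continuation_open[where g = "\<lambda>_. 0" and f = "\<lambda>z. cinner (R z w) (Q y)"
          and s = "ball 0 e" and s' = "ball (0 :: complex) t"])
      show "(\<lambda>z. cinner (R z w) (Q y)) holomorphic_on ball 0 t"
        by (rule vector_holomorphic_on_imp_holomorphic_cinner[OF hol])
      show "cinner (R \<mu> w) (Q y) = 0" if "\<mu> \<in> ball 0 e" for \<mu>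
        using near[OF that] by (simp add: Qsym[symmetric])
      show "ball (0 :: complex) e \<subseteq> ball 0 t" by (auto simp: e_def)
    qed (use e z in auto)
    then show ?thesis by (simp add: Qsym)
  qed
  then have "Q (R z w) = 0"
    by (metis cinner_norm norm_eq_zero of_real_eq_0_iff zero_eq_power2)
  then show ?thesis by (simp add: Q0)
qed

text \<open>
  With \<open>R z\<close> the inverse of \<open>1 - z S\<close> and \<open>G z = S (R z)\<close> one has
  \<open>(T - z) (G z) = 1 - (1 - T S) (R z)\<close>. The operator \<open>T - z\<close> equals \<open>(1 - z S) T - z (1 - S T)\<close>, so
  \<open>- G z\<close> is an inner inverse of \<open>z - T\<close> provided that \<open>(1 - T S) (R z)\<close> annihilates the kernel of \<open>T\<close>. That kernel
  lies in the core, which \<open>R z\<close> preserves and on which \<open>T S\<close> is the identity. The usual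
  correction \<open>F = G (z - T) G\<close> turns the inner inverse into one that is also an outer inverse.
\<close>

lemma inner_inverse_disc_regular:
  fixes T S :: "'a :: complex_hilbert_space \<Rightarrow>\<^sub>L 'a"
  assumes T: "T \<in> clinear_ops" and S: "S \<in> clinear_ops" and TST: "T o\<^sub>L S o\<^sub>L T = T"
    and reg0: "0 \<in> reg T"
    and inv: "\<And>z. z \<in> ball 0 t \<Longrightarrow> op_invertible (id_blinfun - z *\<^sub>C S)"
  shows "ball 0 t \<subseteq> reg T"
proof -
  let ?M = "eigen_core T"
  have tst: "T (S (T x)) = T x" for x using TST by (simp add: blinfun_eq_iff)
  have "(0 *\<^sub>C id_blinfun - T) o\<^sub>L (- S) o\<^sub>L (0 *\<^sub>C id_blinfun - T) = 0 *\<^sub>C id_blinfun - T"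
    by (simp add: blinfun_eq_iff bl_simps tst)
  from eigen_core_generalized_inverse[OF T clinear_ops_intros(5)[OF S] reg0 this]
  have M: "T (S y) = y" "- S y \<in> ?M" if "y \<in> ?M" for y
    using that by (simp_all add: bl_simps)
  have SM: "S y \<in> ?M" if "y \<in> ?M" for y
    using closed_csubspaceD(4)[OF eigen_core_csubspace M(2)[OF that], of "-1"] by (simp add: scaleC_alg)
  have "\<forall>z\<in>ball 0 t. \<exists>B. B \<in> clinear_ops \<and> (id_blinfun - z *\<^sub>C S) o\<^sub>L B = id_blinfun
      \<and> B o\<^sub>L (id_blinfun - z *\<^sub>C S) = id_blinfun"
    using inv by (simp add: op_invertible_def Bex_def)
  then obtain R where "\<forall>z\<in>ball 0 t. R z \<in> clinear_ops \<and> (id_blinfun - z *\<^sub>C S) o\<^sub>L R z = id_blinfun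
      \<and> R z o\<^sub>L (id_blinfun - z *\<^sub>C S) = id_blinfun"
    by (rule bchoice[THEN exE])
  then have R: "\<And>z. z \<in> ball 0 t \<Longrightarrow> R z \<in> clinear_ops"
      "\<And>z. z \<in> ball 0 t \<Longrightarrow> (id_blinfun - z *\<^sub>C S) o\<^sub>L R z = id_blinfun"
      "\<And>z. z \<in> ball 0 t \<Longrightarrow> R z o\<^sub>L (id_blinfun - z *\<^sub>C S) = id_blinfun"
    by blast+
  have hol: "vector_holomorphic_on R (ball 0 t)"
    by (rule vector_holomorphic_on_inverse_pencil[OF R(1) S R(2,3)])
  define J where "J z = z *\<^sub>C id_blinfun - T" for z
  define G where "G z = S o\<^sub>L R z" for z
  define F where "F z = G z o\<^sub>L (J z o\<^sub>L G z)" for z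
  have Jlin: "J z \<in> clinear_ops" for z unfolding J_def using T by (intro clinear_ops_intros)
  have Glin: "G z \<in> clinear_ops" if "z \<in> ball 0 t" for z
    unfolding G_def using S R(1)[OF that] by (intro clinear_ops_intros)
  have Flin: "F ` ball 0 t \<subseteq> clinear_ops"
    unfolding F_def using Jlin Glin by (auto intro!: clinear_ops_intros)
  have Ghol: "vector_holomorphic_on G (ball 0 t)"
    unfolding G_def using S by (intro vector_holomorphic_on_compose vector_holomorphic_on_const hol) auto
  have Fhol: "vector_holomorphic_on F (ball 0 t)"
    unfolding F_def
    by (intro vector_holomorphic_on_compose Ghol)
      (use Glin Jlin in \<open>auto simp: J_def intro: vector_holomorphic_on_linear\<close>)
  have JGJ: "J z (G z (J z x)) = - J z x" if z: "z \<in> ball 0 t" for z x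
  proof -
    \<comment> \<open>the kernel part of \<open>x\<close>\<close>
    define w where "w = x - S (T x)"
    have "T w = 0" by (simp add: w_def bl_simps tst)
    then have wM: "w \<in> ?M" using eigen_core_eigenvector[OF reg0, of w] by simp
    have RwM: "R z w \<in> ?M"
      by (rule resolvent_preserves_invariant_subspace[OF S SM eigen_core_csubspace R wM z])
    have Rw: "z *\<^sub>C S (R z w) = R z w - w"
      using R(2)[OF z] by (simp add: blinfun_eq_iff bl_simps algebra_simps)
    have "J z x = z *\<^sub>C w - (id_blinfun - z *\<^sub>C S) (T x)"
      by (simp add: J_def w_def bl_simps scaleC_alg)
    then have "R z (J z x) = z *\<^sub>C R z w - T x"
      using R(3)[OF z] clinear_opsD[OF R(1)[OF z]] by (simp only: blinfun.diff_right) (simp add: blinfun_eq_iff)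
    then have GJ: "G z (J z x) = (R z w - w) - S (T x)"
      by (simp add: G_def bl_simps clinear_opsD[OF S] Rw)
    have "G z (J z x) = z *\<^sub>C S (R z w) - S (T x)" by (simp only: GJ Rw)
    then have TGJ: "T (G z (J z x)) = z *\<^sub>C R z w - T x"
      by (simp add: bl_simps clinear_opsD[OF T] M(1)[OF RwM] tst)
    have Jx: "J z u = z *\<^sub>C u - T u" for u by (simp add: J_def bl_simps)
    have "J z (G z (J z x)) = z *\<^sub>C G z (J z x) - T (G z (J z x))" by (rule Jx)
    also have "\<dots> = z *\<^sub>C ((R z w - w) - S (T x)) - (z *\<^sub>C R z w - T x)"
      unfolding TGJ by (simp only: GJ)
    finally show ?thesis by (simp add: J_def w_def bl_simps scaleC_alg)
  qed
  have inner: "J z o\<^sub>L F z o\<^sub>L J z = J z" if "z \<in> ball 0 t" for z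
    using JGJ[OF that] by (simp add: F_def blinfun_eq_iff bl_simps)
  have outer: "F z o\<^sub>L J z o\<^sub>L F z = F z" if "z \<in> ball 0 t" for z
    using JGJ[OF that] by (simp add: F_def blinfun_eq_iff bl_simps)
  show ?thesis
    unfolding subset_eq
  proof
    fix z :: complex assume z: "z \<in> ball 0 t"
    show "z \<in> reg T"
      unfolding reg_iff
      by (intro exI[of _ "ball 0 t"] exI[of _ F] conjI ballI z Flin Fhol)
        (use inner outer in \<open>auto simp: J_def\<close>)
  qed
qed

section \<open>An inner inverse with prescribed spectral radius\<close>

text \<open>
  Norms of local holomorphic inverses are locally bounded, and compactness makes the bound uniform.
  The inverses themselves need not fit together.
\<close>

lemma uniformly_bounded_inner_inverses:
  fixes T :: "'a :: complex_normed_vector \<Rightarrow>\<^sub>L 'a"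
  assumes K: "compact K" "K \<subseteq> reg T"
  shows "\<exists>C>0. \<forall>z\<in>K. \<exists>S\<in>clinear_ops. norm S \<le> C \<and>
    (z *\<^sub>C id_blinfun - T) o\<^sub>L S o\<^sub>L (z *\<^sub>C id_blinfun - T) = z *\<^sub>C id_blinfun - T"
proof -
  define good where "good C z \<longleftrightarrow> (\<exists>S\<in>clinear_ops. norm S \<le> C \<and>
    (z *\<^sub>C id_blinfun - T) o\<^sub>L S o\<^sub>L (z *\<^sub>C id_blinfun - T) = z *\<^sub>C id_blinfun - T)" for C z
  have mono: "good C z \<Longrightarrow> C \<le> D \<Longrightarrow> good D z" for C D z
    unfolding good_def by force
  have loc: "\<exists>V C. open V \<and> z \<in> V \<and> (\<forall>\<mu>\<in>V. good C \<mu>)" if z: "z \<in> K" for z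
  proof -
    obtain U F where U: "open U" "z \<in> U" "U \<subseteq> reg T" "continuous_on U F"
      and F: "\<forall>\<mu>\<in>U. F \<mu> \<in> clinear_ops"
        "\<forall>\<mu>\<in>U. (\<mu> *\<^sub>C id_blinfun - T) o\<^sub>L F \<mu> o\<^sub>L (\<mu> *\<^sub>C id_blinfun - T) = \<mu> *\<^sub>C id_blinfun - T"
      by (rule reg_local_inverse[of z T]) (use z K in blast, rule that)
    define V where "V = U \<inter> F -` ball (F z) 1"
    have "open V" unfolding V_def
      using continuous_open_preimage[OF U(4,1) open_ball] by (simp add: Int_commute)
    moreover have "good (norm (F z) + 1) \<mu>" if "\<mu> \<in> V" for \<mu>
    proof -
      have "norm (F \<mu>) \<le> norm (F z) + norm (F \<mu> - F z)" by (rule norm_triangle_sub)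
      also have "norm (F \<mu> - F z) < 1" using that by (simp add: V_def dist_norm norm_minus_commute)
      finally show ?thesis using F that unfolding good_def V_def
        by (intro bexI[of _ "F \<mu>"]) auto
    qed
    ultimately show ?thesis using U
      by (intro exI[of _ V] exI[of _ "norm (F z) + 1"]) (auto simp: V_def)
  qed
  define f where "f C = (\<Union> {V. open V \<and> (\<forall>\<mu>\<in>V. good C \<mu>)})" for C
  have f: "open (f C)" "\<mu> \<in> f C \<Longrightarrow> good C \<mu>" for C \<mu> by (auto simp: f_def)
  have "K \<subseteq> (\<Union>C\<in>UNIV. f C)" using loc by (force simp: f_def)
  then obtain A where A: "finite A" "K \<subseteq> (\<Union>C\<in>A. f C)"
    using compactE_image[OF K(1), of UNIV f] f(1) by auto
  define C where "C = Max (insert 1 A)"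
  have C: "1 \<le> C" "\<And>D. D \<in> A \<Longrightarrow> D \<le> C" using A(1) by (auto simp: C_def)
  have "good C z" if "z \<in> K" for z using A(2) that f(2) mono C(2) by blast
  then show ?thesis using C(1) unfolding good_def by (intro exI[of _ C]) auto
qed

text \<open>
  The left inverses constructed above are estimated on the whole space, but have to be cut off by a
  projection onto the subspace that they map into; the cut-off changes only the first factor of each power.
\<close>

lemma op_power_compose_projection_growth:
  fixes L P :: "'a :: real_normed_vector \<Rightarrow>\<^sub>L 'a"
  assumes PL: "\<And>x. P (L x) = L x" and rho: "\<rho> \<ge> 0"
    and growth: "\<And>n (x :: 'a). norm (op_power L n x) \<le> C * \<rho> ^ n * norm x"
  shows "norm (op_power (L o\<^sub>L P) n x) \<le> (1 + \<bar>C\<bar> * norm P) * \<rho> ^ n * norm x"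
proof (cases n)
  case (Suc m)
  have "op_power (L o\<^sub>L P) (Suc m) x = op_power L (Suc m) (P x)"
    by (induction m) (simp_all add: PL)
  then have "norm (op_power (L o\<^sub>L P) n x) \<le> C * \<rho> ^ n * norm (P x)"
    using growth[of n "P x"] Suc by metis
  also have "\<dots> \<le> \<bar>C\<bar> * \<rho> ^ n * (norm P * norm x)"
    using rho by (intro mult_mono norm_blinfun) auto
  also have "\<dots> \<le> (1 + \<bar>C\<bar> * norm P) * \<rho> ^ n * norm x"
    using rho by (simp add: algebra_simps)
  finally show ?thesis .
next
  case 0
  then show ?thesis by (simp add: mult_right_mono algebra_simps)
qed

lemma adjoint_op_power_growth:
  fixes A B :: "'a :: complex_inner \<Rightarrow>\<^sub>L 'a"
  assumes adj: "\<And>x y. cinner (A x) y = cinner x (B y)"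
    and growth: "\<And>n (x :: 'a). norm (op_power A n x) \<le> C * \<rho> ^ n * norm x"
  shows "norm (op_power B n y) \<le> C * \<rho> ^ n * norm y"
proof -
  have adjn: "cinner (op_power A n x) y = cinner x (op_power B n y)" for x y
  proof (induction n arbitrary: x y)
    case (Suc n)
    have "cinner (op_power A (Suc n) x) y = cinner (op_power A n x) (B y)" by (simp add: adj)
    also have "\<dots> = cinner x (op_power B (Suc n) y)" using Suc by (simp add: op_power_Suc_apply)
    finally show ?case .
  qed simp
  let ?b = "op_power B n y"
  have "(norm ?b)\<^sup>2 = cmod (cinner ?b ?b)"
    by (simp only: cinner_norm norm_of_real) simp
  also have "\<dots> = cmod (cinner (op_power A n ?b) y)" by (simp add: adjn)
  also have "\<dots> \<le> norm (op_power A n ?b) * norm y" by (rule Cauchy_Schwarz_cinner)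
  also have "\<dots> \<le> (C * \<rho> ^ n * norm ?b) * norm y" by (intro mult_right_mono growth) simp
  finally have le: "norm ?b * norm ?b \<le> norm ?b * (C * \<rho> ^ n * norm y)"
    by (simp add: power2_eq_square mult_ac)
  show ?thesis
  proof (cases "?b = 0")
    case True
    have "0 \<le> norm (op_power A n y)" by simp
    also have "\<dots> \<le> C * \<rho> ^ n * norm y" by (rule growth)
    finally show ?thesis using True by simp
  next
    case False
    then show ?thesis using le by (simp add: mult_le_cancel_left_pos)
  qed
qed

text \<open>
  The constant \<open>\<kappa>\<close> in the growth of the powers is absorbed by passing from \<open>r\<close> to the smaller \<open>s\<close> and to
  a sufficiently high power.
\<close>

lemma left_inverse_of_bounded_below:
  fixes A :: "'a :: complex_hilbert_space \<Rightarrow>\<^sub>L 'a"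
  assumes A: "A \<in> clinear_ops" and inv: "A ` N \<subseteq> N" and N: "closed_csubspace N"
    and c: "c > 0" and s: "0 < s" "s < r"
    and below: "\<And>x z. x \<in> N \<Longrightarrow> cmod z \<le> r \<Longrightarrow> c * norm x \<le> norm (A x - z *\<^sub>C x)"
  shows "\<exists>(L :: 'a \<Rightarrow>\<^sub>L 'a) C. L \<in> clinear_ops \<and> (\<forall>x. L x \<in> N) \<and> (\<forall>x\<in>N. L (A x) = x) \<and>
     (\<forall>n x. norm (op_power L n x) \<le> C * inverse s ^ n * norm x)"
proof -
  have r: "r > 0" using s by simp
  obtain \<kappa> where k: "\<kappa> > 0" "\<And>x n. x \<in> N \<Longrightarrow> \<kappa> * r ^ n * norm x \<le> norm (op_power A n x)"
    using bounded_below_powers[OF A inv N c r below] by blast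
  have sr: "0 < s / r" "s / r < 1" using s r by auto
  obtain K where "(s / r) ^ K < \<kappa>" using real_arch_pow_inv[OF k(1) sr(2)] by blast
  then have "(s / r) ^ Suc K < \<kappa>"
    using sr by (smt (verit) mult_left_le_one_le power_Suc zero_le_power)
  then have sK: "s ^ Suc K \<le> \<kappa> * r ^ Suc K"
    using r by (simp only: power_divide) (simp add: field_simps)
  show ?thesis
  proof (rule left_inverse_with_geometric_growth[OF A inv N s(1), of "Suc K"])
    show "s ^ Suc K * norm x \<le> norm (op_power A (Suc K) x)" if "x \<in> N" for x
      using mult_right_mono[OF sK, of "norm x"] k(2)[OF that, of "Suc K"] by simp
  qed simp
qed

text \<open>
  The diagonal blocks \<open>S1\<close> and \<open>S2\<close> alone decide the invertibility of a block triangular operator: with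
  \<open>R1\<close> and \<open>R2\<close> the resolvents of the blocks, \<open>z\<close> times the operator in question is
  \<open>(z - S1) (1 + z R1 S1 T S2 R2) (z - S2)\<close>, and the middle factor is 1 plus an operator of square zero.
\<close>

lemma op_invertible_triangular:
  fixes S1 S2 T :: "'a :: complex_normed_vector \<Rightarrow>\<^sub>L 'a"
  assumes lin: "S1 \<in> clinear_ops" "S2 \<in> clinear_ops" "T \<in> clinear_ops"
    and orth: "\<And>x. S1 (S2 x) = 0" "\<And>x. S2 (S1 x) = 0"
    and inv: "op_invertible (z *\<^sub>C id_blinfun - S1)" "op_invertible (z *\<^sub>C id_blinfun - S2)"
    and z: "z \<noteq> 0"
  shows "op_invertible (z *\<^sub>C id_blinfun - (S1 + S2 - (S1 o\<^sub>L T o\<^sub>L S2)))"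
proof -
  let ?J1 = "z *\<^sub>C id_blinfun - S1" and ?J2 = "z *\<^sub>C id_blinfun - S2"
  obtain R1 R2 where R1: "R1 \<in> clinear_ops" "?J1 o\<^sub>L R1 = id_blinfun" "R1 o\<^sub>L ?J1 = id_blinfun"
    and R2: "R2 \<in> clinear_ops" "?J2 o\<^sub>L R2 = id_blinfun" "R2 o\<^sub>L ?J2 = id_blinfun"
    using inv by (auto simp: op_invertible_def)
  have J1R: "?J1 (R1 x) = x" "R1 (?J1 x) = x" and J2R: "?J2 (R2 x) = x" "R2 (?J2 x) = x" for x
    using R1 R2 by (auto simp: blinfun_eq_iff)
  have comm: "R (S x) = S (R x)"
    if "R \<in> clinear_ops" "\<And>x. R ((z *\<^sub>C id_blinfun - S) x) = x" "\<And>x. (z *\<^sub>C id_blinfun - S) (R x) = x"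
    for R S :: "'a \<Rightarrow>\<^sub>L 'a" and x
  proof -
    have "z *\<^sub>C R x - R (S x) = x" using that(2)[of x] by (simp add: bl_simps clinear_opsD[OF that(1)])
    moreover have "z *\<^sub>C R x - S (R x) = x" using that(3)[of x] by (simp add: bl_simps)
    ultimately show ?thesis by (metis diff_diff_eq2 add_diff_cancel_left')
  qed
  have c1: "R1 (S1 x) = S1 (R1 x)" and c2: "R2 (S2 x) = S2 (R2 x)" for x
    using comm[OF R1(1), of S1 x] comm[OF R2(1), of S2 x] J1R J2R by blast+
  define N where "N = z *\<^sub>C (R1 o\<^sub>L (S1 o\<^sub>L T o\<^sub>L S2) o\<^sub>L R2)"
  have Nlin: "N \<in> clinear_ops" unfolding N_def using R1 R2 lin by (intro clinear_ops_intros)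
  have "S2 (R2 (R1 (S1 x))) = 0" for x
    by (simp add: c1 c2[symmetric] orth)
  then have "N o\<^sub>L N = 0"
    by (simp add: N_def blinfun_eq_iff bl_simps clinear_opsD R1(1) R2(1) lin)
  then have "op_invertible ((id_blinfun + N))" by (rule op_invertible_nilpotent[OF Nlin])
  then have "op_invertible (?J1 o\<^sub>L (id_blinfun + N) o\<^sub>L ?J2)"
    using inv by (intro op_invertible_compose)
  also have "?J1 o\<^sub>L (id_blinfun + N) o\<^sub>L ?J2 = z *\<^sub>C (z *\<^sub>C id_blinfun - (S1 + S2 - (S1 o\<^sub>L T o\<^sub>L S2)))"
  proof (rule blinfun_eqI)
    fix x
    have "?J1 (N (?J2 x)) = z *\<^sub>C S1 (T (S2 x))"
    proof -
      have "N (?J2 x) = z *\<^sub>C R1 (S1 (T (S2 x)))" by (simp only: N_def scaleC_blinfun.rep_eq blinfun_apply_blinfun_compose J2R)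
      moreover have "?J1 \<in> clinear_ops" using lin by (intro clinear_ops_intros)
      ultimately show ?thesis by (simp only: clinear_opsD J1R)
    qed
    moreover have "?J1 (?J2 x) = z *\<^sub>C (z *\<^sub>C x - S1 x - S2 x)"
      by (simp add: bl_simps scaleC_alg clinear_opsD lin orth)
    ultimately show "(?J1 o\<^sub>L (id_blinfun + N) o\<^sub>L ?J2) x
        = (z *\<^sub>C (z *\<^sub>C id_blinfun - (S1 + S2 - (S1 o\<^sub>L T o\<^sub>L S2)))) x"
      by (simp only: blinfun_apply_blinfun_compose blinfun.add_left blinfun.add_right)
        (simp add: bl_simps scaleC_alg)
  qed
  finally have "op_invertible (inverse z *\<^sub>C (z *\<^sub>C (z *\<^sub>C id_blinfun - (S1 + S2 - (S1 o\<^sub>L T o\<^sub>L S2)))))"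
    by (rule op_invertible_scaleC) (use z in simp)
  then show ?thesis using z by (simp add: scaleC_scaleC)
qed

text \<open>
  Let \<open>M\<close> be the core, \<open>P\<close> its orthogonal projection and \<open>Q = 1 - P\<close>. For \<open>\<bar>z\<bar> \<le> r\<close> the inner inverses of
  \<open>z - T\<close> show that \<open>z - T\<close> maps \<open>M\<close> onto itself, with preimages of controlled norm, and is bounded below modulo \<open>M\<close>. In terms of
  lower bounds: the translates of \<open>A1 = P T*\<close> are bounded below on \<open>M\<close>, and those of \<open>A2 = Q T\<close> are
  bounded below on the orthogonal complement \<open>W\<close>. Both have left inverses whose powers grow at most
  like \<open>s^(-n)\<close>. The adjoint of the first is a right inverse \<open>S1\<close> of \<open>T\<close> on \<open>M\<close>, the second is a left
  inverse \<open>S2\<close> of \<open>T\<close> modulo \<open>M\<close>. The block triangular operator \<open>S = S1 + S2 - S1 T S2\<close> combines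
  them: its off-diagonal term is chosen such that \<open>T S = 1\<close> on \<open>M\<close> and \<open>S T = 1\<close> on \<open>W\<close>, which gives
  \<open>T S T = T\<close>, and it does not contribute to the spectrum.
\<close>

lemma inner_inverse_with_small_spectrum:
  fixes T :: "'a :: complex_hilbert_space \<Rightarrow>\<^sub>L 'a"
  assumes T: "T \<in> clinear_ops" and r: "cball 0 r \<subseteq> reg T" and s: "0 < s" "s < r"
  shows "\<exists>S\<in>clinear_ops. T o\<^sub>L S o\<^sub>L T = T \<and>
    (\<forall>z. inverse s < cmod z \<longrightarrow> op_invertible (z *\<^sub>C id_blinfun - S))"
proof -
  define M where "M = eigen_core T"
  have M: "closed_csubspace M" unfolding M_def by (rule eigen_core_csubspace)
  have TM: "T x \<in> M" if "x \<in> M" for x using eigen_core_invariant[OF T, of x] that by (simp add: M_def)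
  obtain P where P: "P \<in> clinear_ops" "\<And>x. P x \<in> M" "\<And>x. x \<in> M \<Longrightarrow> P x = x"
    "\<And>x y. cinner (P x) y = cinner x (P y)"
    using orthogonal_projection_exists[OF M] by metis
  define Q where "Q = id_blinfun - P"
  have Qlin: "Q \<in> clinear_ops" unfolding Q_def using P by (intro clinear_ops_intros)
  have Qx: "Q x = x - P x" for x by (simp add: Q_def bl_simps)
  have PP: "P (P x) = P x" for x using P by blast
  have PQ: "P (Q x) = 0" for x by (simp add: Qx blinfun.diff_right PP)
  define W where "W = blinfun_apply P -` {0}"
  have W: "closed_csubspace W"
    unfolding W_def by (intro closed_csubspace_vimage closed_csubspace_zero P)
  have QW: "Q x \<in> W" for x by (simp add: W_def PQ)
  have Wx: "Q x = x" if "x \<in> W" for x using that by (simp add: W_def Qx)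
  have QM: "Q x = 0" if "x \<in> M" for x using P(3)[OF that] by (simp add: Qx)
  obtain B where B: "B \<in> clinear_ops" "\<And>x y. cinner (T x) y = cinner x (B y)"
    using adjoint_exists[OF T] by metis
  obtain C where C: "C > 0" and gi: "\<And>z. z \<in> cball 0 r \<Longrightarrow> \<exists>S\<in>clinear_ops. norm S \<le> C \<and>
    (z *\<^sub>C id_blinfun - T) o\<^sub>L S o\<^sub>L (z *\<^sub>C id_blinfun - T) = z *\<^sub>C id_blinfun - T"
    using uniformly_bounded_inner_inverses[OF compact_cball r] by blast

  define A1 where "A1 = P o\<^sub>L B"
  have A1: "A1 \<in> clinear_ops" "A1 ` M \<subseteq> M"
    unfolding A1_def using P B by (auto intro: clinear_ops_intros)
  \<comment> \<open>duality: \<open><x, x>\<close> is evaluated with a preimage \<open>S x\<close> of \<open>x\<close> inside \<open>M\<close>; the adjoint conjugates the parameter\<close>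
  have below1: "inverse C * norm x \<le> norm (A1 x - z *\<^sub>C x)" if x: "x \<in> M" and z: "cmod z \<le> r" for x z
  proof -
    have cz: "cnj z \<in> cball 0 r" using z by simp
    obtain S where S: "S \<in> clinear_ops" "norm S \<le> C"
      "(cnj z *\<^sub>C id_blinfun - T) o\<^sub>L S o\<^sub>L (cnj z *\<^sub>C id_blinfun - T) = cnj z *\<^sub>C id_blinfun - T"
      using gi[OF cz] by blast
    have "cnj z \<in> reg T" using cz r by blast
    from eigen_core_generalized_inverse[OF T S(1) this S(3), of x]
    have Sx: "cnj z *\<^sub>C S x - T (S x) = x" "S x \<in> M"
      using x by (simp_all add: M_def)
    have "cinner x x = cinner (cnj z *\<^sub>C S x - T (S x)) x" by (simp add: Sx)
    also have "\<dots> = cinner (S x) (z *\<^sub>C x) - cinner (P (S x)) (B x)"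
      using P(3)[OF Sx(2)] by (simp add: cinner_diff_left cinner_scaleC_left cinner_scaleC_right B(2))
    also have "\<dots> = cinner (S x) (z *\<^sub>C x - A1 x)"
      by (simp add: cinner_diff_right A1_def P(4))
    finally have "(norm x)\<^sup>2 = cmod (cinner (S x) (z *\<^sub>C x - A1 x))"
      by (metis cinner_norm norm_of_real abs_of_nonneg zero_le_power2)
    also have "\<dots> \<le> norm (S x) * norm (z *\<^sub>C x - A1 x)" by (rule Cauchy_Schwarz_cinner)
    also have "\<dots> \<le> (C * norm x) * norm (A1 x - z *\<^sub>C x)"
      using order_trans[OF norm_blinfun[of S x] mult_right_mono[OF S(2) norm_ge_zero]]
      by (subst norm_minus_commute) (intro mult_right_mono, auto)
    finally have le: "norm x * norm x \<le> norm x * (C * norm (A1 x - z *\<^sub>C x))"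
      by (simp add: power2_eq_square mult_ac)
    show ?thesis
    proof (cases "x = 0")
      case False
      then have "norm x \<le> C * norm (A1 x - z *\<^sub>C x)" using le by (simp add: mult_le_cancel_left_pos)
      then show ?thesis using C by (simp add: field_simps)
    qed simp
  qed
  have C': "inverse C > 0" using C by simp
  obtain L1 C1 where L1: "L1 \<in> clinear_ops" "\<forall>x. blinfun_apply L1 x \<in> M" "\<forall>x\<in>M. L1 (A1 x) = x"
    "\<forall>n x. norm (op_power L1 n x) \<le> C1 * inverse s ^ n * norm x"
    using left_inverse_of_bounded_below[OF A1 M C' s below1] by blast

  define A2 where "A2 = Q o\<^sub>L T"
  have A2: "A2 \<in> clinear_ops" "A2 ` W \<subseteq> W"
    unfolding A2_def using Qlin T QW by (auto intro: clinear_ops_intros)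
  define D where "D = (1 + norm Q) * C"
  have D: "D > 0" using C by (simp add: D_def add_pos_nonneg)
  \<comment> \<open>modulo \<open>M\<close>, an inner inverse is a left inverse, since the kernel of \<open>z - T\<close> lies in \<open>M\<close>\<close>
  have below2: "inverse D * norm x \<le> norm (A2 x - z *\<^sub>C x)" if x: "x \<in> W" and z: "cmod z \<le> r" for x z
  proof -
    let ?J = "z *\<^sub>C id_blinfun - T"
    have cz: "z \<in> cball 0 r" using z by simp
    obtain S where S: "S \<in> clinear_ops" "norm S \<le> C" "?J o\<^sub>L S o\<^sub>L ?J = ?J"
      using gi[OF cz] by blast
    have reg: "z \<in> reg T" using cz r by blast
    define d where "d = S (?J x) - x"
    have "?J d = 0"
      using S(3) unfolding d_def by (simp only: blinfun.diff_right) (simp add: blinfun_eq_iff)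
    then have "T d = z *\<^sub>C d" by (simp add: bl_simps)
    then have "d \<in> M" unfolding M_def by (rule eigen_core_eigenvector[OF reg])
    then have "Q d = 0" by (rule QM)
    then have QSJ: "Q (S (?J x)) = x" using Wx[OF x] by (simp add: d_def blinfun.diff_right)
    have "S (P (?J x)) \<in> M"
      using eigen_core_generalized_inverse(2)[OF T S(1) reg S(3)] P(2)
      unfolding M_def by blast
    then have "Q (S (P (?J x))) = 0" by (rule QM)
    then have "x = Q (S (Q (?J x)))" using QSJ by (simp only: Qx[of "?J x"] blinfun.diff_right) simp
    also have "Q (?J x) = z *\<^sub>C x - A2 x"
      using Wx[OF x] by (simp add: A2_def bl_simps clinear_opsD[OF Qlin])
    finally have "norm x = norm (Q (S (z *\<^sub>C x - A2 x)))" by simp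
    also have "\<dots> \<le> norm Q * norm (S (z *\<^sub>C x - A2 x))" by (rule norm_blinfun)
    also have "\<dots> \<le> norm Q * (C * norm (z *\<^sub>C x - A2 x))"
      using order_trans[OF norm_blinfun mult_right_mono[OF S(2) norm_ge_zero]]
      by (intro mult_left_mono) auto
    also have "\<dots> \<le> D * norm (A2 x - z *\<^sub>C x)"
      using C by (subst norm_minus_commute) (simp add: D_def algebra_simps)
    finally show ?thesis using D by (simp add: field_simps)
  qed
  have D': "inverse D > 0" using D by simp
  obtain L2 C2 where L2: "L2 \<in> clinear_ops" "\<forall>x. blinfun_apply L2 x \<in> W" "\<forall>x\<in>W. L2 (A2 x) = x"
    "\<forall>n x. norm (op_power L2 n x) \<le> C2 * inverse s ^ n * norm x"
    using left_inverse_of_bounded_below[OF A2 W D' s below2] by blast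

  have "L1 o\<^sub>L P \<in> clinear_ops" using L1 P by (intro clinear_ops_intros)
  then obtain S1 where S1: "S1 \<in> clinear_ops" "\<And>x y. cinner ((L1 o\<^sub>L P) x) y = cinner x (S1 y)"
    using adjoint_exists by metis
  define S2 where "S2 = L2 o\<^sub>L Q"
  have S2: "S2 \<in> clinear_ops" unfolding S2_def using L2 Qlin by (intro clinear_ops_intros)
  have PS1: "P (S1 y) = S1 y" for y
    by (rule cinner_eqI[of UNIV]) (simp_all add: P(4)[symmetric] S1(2)[symmetric] PP)
  have S1P: "S1 (P y) = S1 y" for y
    by (rule cinner_eqI[of UNIV]) (use L1 P(3) in \<open>simp_all add: P(4)[symmetric] S1(2)[symmetric]\<close>)
  have S1M: "S1 y \<in> M" for y using P(2)[of "S1 y"] by (simp add: PS1)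
  have S2M: "S2 x = 0" if "x \<in> M" for x using QM[OF that] by (simp add: S2_def)
  have S2W: "P (S2 y) = 0" for y using L2(2) by (simp add: S2_def W_def)
  have S12: "S1 (S2 x) = 0" for x using S1P[of "S2 x"] by (simp add: S2W)
  have S21: "S2 (S1 x) = 0" for x by (rule S2M[OF S1M])
  have TS1: "T (S1 y) = y" if y: "y \<in> M" for y
  proof (rule cinner_eqI[of M])
    fix x assume x: "x \<in> M"
    have "cinner (T (S1 y)) x = cinner (P (S1 y)) (B x)" by (simp add: B PS1)
    also have "\<dots> = cinner (S1 y) (A1 x)" by (simp add: P(4) A1_def)
    finally have "cinner x (T (S1 y)) = cinner (A1 x) (S1 y)" by (metis cinner_commute)
    also have "\<dots> = cinner (L1 (P (A1 x))) y" by (simp add: S1(2)[symmetric])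
    also have "P (A1 x) = A1 x" using A1 x P(3) by blast
    also have "L1 (A1 x) = x" using L1 x by blast
    finally show "cinner x (T (S1 y)) = cinner x y" .
  qed (use TM[OF S1M] y closed_csubspaceD(5)[OF M] in blast)
  have S2T: "S2 (T x) = x" if "x \<in> W" for x
    using L2(3) that by (simp add: S2_def A2_def)
  define S where "S = S1 + S2 - (S1 o\<^sub>L T o\<^sub>L S2)"
  have Slin: "S \<in> clinear_ops" unfolding S_def using S1 S2 T by (intro clinear_ops_intros)
  have "T (S (T x)) = T x" for x
  proof -
    have "S (T (P x)) = S1 (T (P x))" using S2M[OF TM[OF P(2)]] by (simp add: S_def bl_simps)
    then have 1: "T (S (T (P x))) = T (P x)" using TS1[OF TM[OF P(2)]] by simp
    have 2: "S (T (Q x)) = Q x" using S2T[OF QW] by (simp add: S_def bl_simps)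
    have "T (S (T x)) = T (S (T (P x + Q x)))" by (simp add: Qx)
    also have "\<dots> = T (P x + Q x)" by (simp only: blinfun.add_right 1 2)
    finally show ?thesis by (simp add: Qx)
  qed
  then have TST: "T o\<^sub>L S o\<^sub>L T = T" by (simp add: blinfun_eq_iff)
  have rho: "inverse s \<ge> 0" using s by simp
  have "op_invertible (z *\<^sub>C id_blinfun - S)" if z: "inverse s < cmod z" for z
    unfolding S_def
  proof (rule op_invertible_triangular[OF S1(1) S2 T S12 S21])
    have PL1: "P (L1 x) = L1 x" for x using L1 P by blast
    have QL2: "Q (L2 x) = L2 x" for x using L2 Wx by blast
    have g1: "norm (op_power S1 n x) \<le> (1 + \<bar>C1\<bar> * norm P) * inverse s ^ n * norm x" for n x
      by (rule adjoint_op_power_growth[OF S1(2) op_power_compose_projection_growth[OF PL1 rho]])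
        (use L1(4) in blast)
    have g2: "norm (op_power S2 n x) \<le> (1 + \<bar>C2\<bar> * norm Q) * inverse s ^ n * norm x" for n x
      unfolding S2_def by (rule op_power_compose_projection_growth[OF QL2 rho]) (use L2(4) in blast)
    show "op_invertible (z *\<^sub>C id_blinfun - S1)"
      by (rule op_invertible_if_geometric_growth[OF S1(1) rho z g1])
    show "op_invertible (z *\<^sub>C id_blinfun - S2)"
      by (rule op_invertible_if_geometric_growth[OF S2 rho z g2])
    show "z \<noteq> 0" using z s by auto
  qed
  then show ?thesis using Slin TST by blast
qed

section \<open>The distance formula\<close>

theorem theorem2p3:
  fixes T :: "'a :: complex_hilbert_space \<Rightarrow>\<^sub>L 'a"
  assumes separable: "separable_space (euclidean :: 'a topology)"
    and infinite_dim: "\<not> (\<exists>B :: 'a set. finite B \<and> cspan B = UNIV)"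
    and T: "T \<in> clinear_ops"
    and regular: "0 \<in> reg T"
  shows "(INF z\<in>generalized_spectrum T. ereal (cmod z)) =
    (SUP S\<in>{S \<in> clinear_ops. T o\<^sub>L S o\<^sub>L T = T}. 1 / spectral_radius S)"
    (is "?inf = ?sup")
proof (rule antisym)
  show "?sup \<le> ?inf"
  proof (intro SUP_least INF_greatest)
    fix S z assume "S \<in> {S \<in> clinear_ops. T o\<^sub>L S o\<^sub>L T = T}" and z: "z \<in> generalized_spectrum T"
    then have S: "S \<in> clinear_ops" "T o\<^sub>L S o\<^sub>L T = T" by auto
    show "1 / spectral_radius S \<le> ereal (cmod z)"
    proof (rule ccontr)
      assume "\<not> 1 / spectral_radius S \<le> ereal (cmod z)"
      then obtain t where t: "cmod z < t" "ereal t < 1 / spectral_radius S"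
        using ereal_dense2[of "ereal (cmod z)" "1 / spectral_radius S"] by (auto simp: not_le)
      have "op_invertible (id_blinfun - w *\<^sub>C S)" if w: "w \<in> ball 0 t" for w
      proof (cases "w = 0")
        case True
        then show ?thesis
          by (auto simp: op_invertible_def intro!: bexI[of _ id_blinfun] clinear_ops_intros blinfun_eqI)
      next
        case False
        have "inverse w \<notin> op_spectrum S"
        proof
          assume "inverse w \<in> op_spectrum S"
          then have ub: "ereal (cmod (inverse w)) \<le> spectral_radius S"
            unfolding spectral_radius_def by (rule SUP_upper)
          have "1 / spectral_radius S \<le> ereal (cmod w)"
          proof (cases "spectral_radius S")
            case (real r)
            have "0 < inverse (cmod w)" using False by simp
            moreover have le: "inverse (cmod w) \<le> r"
              using ub by (simp add: real norm_inverse)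
            ultimately have "r > 0" by linarith
            then have "1 / r \<le> cmod w" using le False by (simp add: field_simps)
            then show ?thesis using \<open>r > 0\<close> by (simp add: real one_ereal_def)
          qed (use ub in auto)
          then have "ereal t < ereal (cmod w)" using t by (meson less_le_trans)
          then show False using w by simp
        qed
        then have "op_invertible (inverse w *\<^sub>C id_blinfun - S)" by (simp add: op_spectrum_iff)
        from op_invertible_scaleC[OF this False]
        show ?thesis using False by (simp add: scaleC_alg)
      qed
      then have "ball 0 t \<subseteq> reg T"
        by (rule inner_inverse_disc_regular[OF T S regular])
      then show False using z t by (auto simp: generalized_spectrum_def)
    qed
  qed
next
  obtain x :: 'a where x: "x \<noteq> 0"
  proof -
    have "cspan {} \<noteq> (UNIV :: 'a set)" using infinite_dim by blast
    then show ?thesis using that by (auto simp: complex_vector.span_empty)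
  qed
  have pos: "0 < ?inf"
  proof -
    obtain U where U: "open U" "0 \<in> U" "U \<subseteq> reg T" using reg_local_inverse[OF regular] by metis
    then obtain e where e: "e > 0" "ball 0 e \<subseteq> U" using open_contains_ball by blast
    have "ereal e \<le> ?inf"
      by (rule INF_greatest) (use e U in \<open>force simp: generalized_spectrum_def\<close>)
    then show ?thesis using e by (metis ereal_less(2) less_le_trans)
  qed
  show "?inf \<le> ?sup"
  proof (rule dense_le)
    fix y assume "y < ?inf"
    then have "max y 0 < ?inf" using pos by simp
    then obtain s where s: "max y 0 < ereal s" "ereal s < ?inf" using ereal_dense2 by blast
    then obtain r where r: "ereal s < ereal r" "ereal r < ?inf" using ereal_dense2 by blast
    have s0: "0 < s" and sr: "s < r" using s r by auto
    have "cball 0 r \<subseteq> reg T"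
    proof (rule ccontr)
      assume "\<not> cball 0 r \<subseteq> reg T"
      then obtain z where "z \<in> cball 0 r" "z \<notin> reg T" by blast
      then have "cmod z \<le> r" "z \<in> generalized_spectrum T"
        by (simp_all add: generalized_spectrum_def)
      then have "?inf \<le> ereal r" by (intro INF_lower2[of z]) auto
      then show False using r by simp
    qed
    then obtain S where S: "S \<in> clinear_ops" "T o\<^sub>L S o\<^sub>L T = T"
      and inv: "\<And>z. inverse s < cmod z \<Longrightarrow> op_invertible (z *\<^sub>C id_blinfun - S)"
      using inner_inverse_with_small_spectrum[OF T _ s0 sr] by blast
    have up: "spectral_radius S \<le> ereal (inverse s)"
      unfolding spectral_radius_def
      by (rule SUP_least) (use inv in \<open>force simp: op_spectrum_iff not_less[symmetric]\<close>)
    \<comment> \<open>a nonempty spectrum rules out the value \<open>-\<infinity>\<close> of the supremum, for which the quotient would be 0\<close>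
    obtain z where "z \<in> op_spectrum S" using op_spectrum_nonempty[OF S(1) x] by blast
    then have "ereal (cmod z) \<le> spectral_radius S"
      unfolding spectral_radius_def by (rule SUP_upper)
    then have low: "0 \<le> spectral_radius S" by (rule order_trans[rotated]) simp
    have "ereal s \<le> 1 / spectral_radius S"
    proof (cases "spectral_radius S")
      case (real q)
      then show ?thesis
        using up low s0 by (cases "q = 0") (auto simp: one_ereal_def field_simps)
    qed (use up low in auto)
    also have "\<dots> \<le> ?sup" using S by (intro SUP_upper) auto
    finally show "y \<le> ?sup" using s by (meson le_max_iff_disj less_imp_le order_trans max.strict_boundedE)
  qed
qed

end
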